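(* Under the standing assumptions on $G_n$, $\mathcal S$ and the weights given in the context, for any $\beta\in[0,\infty)$, $$\frac1m\log Z(\beta,\boldsymbol\omega)\to\psi(\beta)\qquad\text{and}\qquad \frac1m\langle W(\pi)\rangle_\beta\to-\psi'(\beta)$$ in probability as $n\to\infty$.
   Context: Graphs: $G_n=(V_n,E_n)$, $n\in\mathbb N$, is a sequence of finite undirected edge-transitive graphs with $|V_n|=c\cdot n$ for some fixed $c\in\mathbb N$ and $|E_n|=\Theta(|V_n|^2)$. Weights: $\boldsymbol\omega=\{\omega_e\}_{e\in E_n}$ are i.i.d. with a law not depending on $n$ and such that $\psi(\beta):=\log\mathbb E e^{-\beta\omega_e}<\infty$ for all $\beta\in[0,\infty)$. Weights may equal $+\infty$ with positive probability (but not almost surely), with the conventions $e^{-\beta\cdot(+\infty)}=0$ for every $\beta\ge0$ and $(+\infty)\cdot0=0$. The derivative of $\psi$ at $0$ is the right derivative; derivatives appearing in the statement are understood to exist and be finite. Optimization problem: $\mathcal S=\mathcal S(n)$ is a nonempty collection of spanning subgraphs of $G_n$, identified with their edge sets; $\widetilde{\mathcal S}$ is the collection of all subsets of elements of $\mathcal S$. A partial matching is a set of pairwise vertex-disjoint edges. $\mathbb P_0$ denotes the law of $\pi$ uniform on $\mathcal S$. It is assumed that: (1) all elements of $\mathcal S$ have the same number of edges $m=m(n)$, and $\lim_{n\to\infty} m^2/(2|E_n|)=\gamma\in(0,\infty)$; (2) for every partial matching $\Gamma\subseteq E_n$ there is $\pi\in\mathcal S$ with $\Gamma\subseteq\pi$;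 (3) there is a constant $\rho\in(0,\infty)$ (independent of $n$) such that for every $k\in\mathbb N$ and every partial matching $\Gamma$ with $k$ edges, $\left|\frac{\mathbb P_0(\Gamma\subseteq\pi)}{\prod_{e\in\Gamma}\mathbb P_0(e\in\pi)}-1\right|\le \frac{\rho^k}{\sqrt m}$; (4) there is a constant $\rho\in(0,\infty)$ (independent of $n$) such that for every $k\in\mathbb N$ and every $\Gamma\in\widetilde{\mathcal S}$ with $k$ edges that is not a partial matching, $\mathbb P_0(\Gamma\subseteq\pi)\le\rho^k\prod_{e\in\Gamma}\mathbb P_0(e\in\pi)$. Moreover $\mathbb P_0(e\in\pi)=p:=m/|E_n|$ for every $e\in E_n$. Gibbs measure: $W(\pi)=\sum_{e\in\pi}\omega_e$, $Z(\beta,\boldsymbol\omega)=\frac1{|\mathcal S|}\sum_{\pi\in\mathcal S}e^{-\beta W(\pi)}$, $\mathbb P_{\beta,\boldsymbol\omega}(\pi)=\frac{1}{Z(\beta,\boldsymbol\omega)|\mathcal S|}e^{-\beta W(\pi)}$ for $\pi\in\mathcal S$ (uniform if $Z=0$, with $\log 0=-\infty$). $\langle\cdot\rangle_\beta$ is the expectation over $\pi\sim\mathbb P_{\beta,\boldsymbol\omega}$ with $\boldsymbol\omega$ held fixed. *)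

theory Defs
  imports "HOL-Probability.Probability" "HOL-Library.Landau_Symbols"
begin

section \<open>Finite simple graphs\<close>

definition simple_graph :: "'v set \<Rightarrow> 'v set set \<Rightarrow> bool" where
  "simple_graph V E \<longleftrightarrow> finite V \<and> (\<forall>e\<in>E. e \<subseteq> V \<and> card e = 2)"

definition graph_automorphism :: "'v set \<Rightarrow> 'v set set \<Rightarrow> ('v \<Rightarrow> 'v) \<Rightarrow> bool" where
  "graph_automorphism V E \<phi> \<longleftrightarrow> bij_betw \<phi> V V \<and> (\<forall>u\<in>V. \<forall>v\<in>V. {u, v} \<in> E \<longleftrightarrow> {\<phi> u, \<phi> v} \<in> E)"

definition edge_transitive :: "'v set \<Rightarrow> 'v set set \<Rightarrow> bool" where
  "edge_transitive V E \<longleftrightarrow> (\<forall>e\<in>E. \<forall>f\<in>E. \<exists>\<phi>. graph_automorphism V E \<phi> \<and> \<phi> ` e = f)"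

definition partial_matching :: "'v set set \<Rightarrow> 'v set set \<Rightarrow> bool" where
  "partial_matching E \<Gamma> \<longleftrightarrow> \<Gamma> \<subseteq> E \<and> pairwise disjnt \<Gamma>"

section \<open>The optimization problem\<close>

text \<open>Spanning subgraphs are identified with their edge sets, so a collection of them is a
  set \<open>S\<close> of sets of edges.\<close>

definition down_closure :: "'e set set \<Rightarrow> 'e set set" where
  "down_closure S = {\<Gamma>. \<exists>\<pi>\<in>S. \<Gamma> \<subseteq> \<pi>}"

definition P0_incl :: "'e set set \<Rightarrow> 'e set \<Rightarrow> real" where
  "P0_incl S \<Gamma> = measure_pmf.prob (pmf_of_set S) {\<pi>. \<Gamma> \<subseteq> \<pi>}"

section \<open>Weights and Gibbs measure\<close>

text \<open>Weights take values in \<open>(-\<infinity>, \<infinity>]\<close>. The convention \<open>e\<^sup>-\<^sup>\<beta>\<^sup>x = 0\<close> for \<open>x = \<infinity>\<close> applies to every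
  \<open>\<beta> \<ge> 0\<close>, in particular to \<open>\<beta> = 0\<close>. The value at \<open>x = -\<infinity>\<close> is irrelevant.\<close>

definition boltzmann :: "real \<Rightarrow> ereal \<Rightarrow> real" where
  "boltzmann \<beta> x = (if x = \<infinity> then 0 else exp (- \<beta> * real_of_ereal x))"

definition log_laplace :: "ereal measure \<Rightarrow> real \<Rightarrow> real" where
  "log_laplace \<mu> \<beta> = ln (\<integral>x. boltzmann \<beta> x \<partial>\<mu>)"

definition total_weight :: "('e \<Rightarrow> ereal) \<Rightarrow> 'e set \<Rightarrow> ereal" where
  "total_weight w \<pi> = (\<Sum>e\<in>\<pi>. w e)"

definition partition_function :: "'e set set \<Rightarrow> real \<Rightarrow> ('e \<Rightarrow> ereal) \<Rightarrow> real" where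
  "partition_function S \<beta> w = (1 / real (card S)) * (\<Sum>\<pi>\<in>S. boltzmann \<beta> (total_weight w \<pi>))"

definition log_partition :: "'e set set \<Rightarrow> real \<Rightarrow> ('e \<Rightarrow> ereal) \<Rightarrow> ereal" where
  "log_partition S \<beta> w =
     (if partition_function S \<beta> w = 0 then - \<infinity> else ereal (ln (partition_function S \<beta> w)))"

definition gibbs :: "'e set set \<Rightarrow> real \<Rightarrow> ('e \<Rightarrow> ereal) \<Rightarrow> 'e set \<Rightarrow> real" where
  "gibbs S \<beta> w \<pi> =
     (if partition_function S \<beta> w = 0 then 1 / real (card S)
      else boltzmann \<beta> (total_weight w \<pi>) / (partition_function S \<beta> w * real (card S)))"

text \<open>The product below is the one of \<^typ>\<open>ereal\<close>, for which \<open>\<infinity> * 0 = 0\<close>.\<close>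

definition gibbs_mean :: "'e set set \<Rightarrow> real \<Rightarrow> ('e \<Rightarrow> ereal) \<Rightarrow> ('e set \<Rightarrow> ereal) \<Rightarrow> ereal" where
  "gibbs_mean S \<beta> w f = (\<Sum>\<pi>\<in>S. f \<pi> * ereal (gibbs S \<beta> w \<pi>))"

section \<open>Convergence in probability to a real constant\<close>

text \<open>The random variables may be infinite and may live on different probability spaces; where
  \<open>X n x\<close> is infinite, its distance to \<open>a\<close> is \<open>\<infinity>\<close>.\<close>

definition tendsto_in_prob :: "(nat \<Rightarrow> 'w measure) \<Rightarrow> (nat \<Rightarrow> 'w \<Rightarrow> ereal) \<Rightarrow> real \<Rightarrow> bool" where
  "tendsto_in_prob M X a \<longleftrightarrow>
     (\<forall>\<epsilon>>0. (\<lambda>n. measure (M n) {x \<in> space (M n). \<bar>X n x - ereal a\<bar> > ereal \<epsilon>}) \<longlonglongrightarrow> 0)"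

end

theory Submission
  imports Defs
begin

text \<open>Let \<open>Zbar = Z / E Z\<close>, let \<open>g(\<omega>\<^sub>e) = e\<^sup>-\<^sup>\<beta>\<^sup>\<omega> / E e\<^sup>-\<^sup>\<beta>\<^sup>\<omega>\<close> be the normalised factor of an edge, and compare \<open>Zbar\<close>
  with the product \<open>X\<close> of \<open>1 + p (g(\<omega>\<^sub>e) - 1)\<close> over all edges. The second moment of \<open>Zbar\<close> is a sum
  over edge sets \<open>\<Gamma>\<close> of \<open>Var(g)\<^sup>k P\<^sub>0(\<Gamma> \<subseteq> \<pi>)\<^sup>2\<close> with \<open>k = |\<Gamma>|\<close>: partial matchings contribute what they do for
  \<open>X\<close>, up to a relative error of order \<open>1 / sqrt m\<close>, and the other sets are negligible because they
  contain one of at most \<open>|V|\<^sup>3\<close> pairs of adjacent edges while \<open>p\<close> is of order \<open>1 / |V|\<close>. Hence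
  \<open>Zbar - X\<close> tends to 0 in \<open>L\<^sup>2\<close>. As \<open>E (1 / X)\<close> stays bounded, \<open>Zbar\<close> is bounded away from 0 with
  probability close to 1; with \<open>E Zbar = 1\<close> this gives the limit of \<open>log Z / m\<close>.

  For the mean weight, a change of measure makes \<open>E (Zbar \<langle>|W(\<pi>) / m - a|\<rangle>)\<close> the mean absolute
  deviation of an average of \<open>m\<close> i.i.d. variables with the tilted law. By monotone convergence of the right
  difference quotients of \<open>E e\<^sup>-\<^sup>\<beta>\<^sup>\<omega>\<close>, the tilted law has mean \<open>a = - \<psi>'(\<beta>)\<close>, so the weak law of
  large numbers applies, and the lower bound on \<open>Zbar\<close> removes the factor \<open>Zbar\<close>.\<close>

section \<open>Overlaps of two random subgraphs\<close>

lemma sum_Pow_power_card: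
  fixes u :: "'b::comm_semiring_1"
  assumes "finite A"
  shows "(\<Sum>\<Gamma>\<in>Pow A. u ^ card \<Gamma>) = (1 + u) ^ card A"
  using prod_add[OF assms, of "\<lambda>_. u" "\<lambda>_. 1"] by (simp add: add.commute)

lemma P0_incl_eq:
  assumes "finite S" "S \<noteq> {}"
  shows "P0_incl S \<Gamma> = real (card {\<pi>\<in>S. \<Gamma> \<subseteq> \<pi>}) / real (card S)"
proof -
  have "S \<inter> {\<pi>. \<Gamma> \<subseteq> \<pi>} = {\<pi>\<in>S. \<Gamma> \<subseteq> \<pi>}" by auto
  thus ?thesis using assms by (simp add: P0_incl_def measure_pmf_of_set)
qed

text \<open>Expanding \<open>(1 + s) ^ card (\<pi> \<inter> \<pi>')\<close> over the subsets
  \<open>\<Gamma>\<close> of the overlap separates the pair: \<open>\<Gamma>\<close> lies in the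
  overlap iff it lies in both sets, so averaging over two independent uniform elements of
  \<open>S\<close> produces the square of \<open>P0_incl S \<Gamma>\<close>. In this form the
  assumptions on inclusion probabilities apply.\<close>

lemma overlap_moment:
  fixes s :: real
  assumes E: "finite E" and S: "S \<noteq> {}" "\<And>\<pi>. \<pi> \<in> S \<Longrightarrow> \<pi> \<subseteq> E"
  shows "(\<Sum>\<pi>\<in>S. \<Sum>\<pi>'\<in>S. (1 + s) ^ card (\<pi> \<inter> \<pi>')) / (real (card S))\<^sup>2 =
    (\<Sum>\<Gamma>\<in>Pow E. s ^ card \<Gamma> * (P0_incl S \<Gamma>)\<^sup>2)"
proof -
  have fS: "finite S" using S E by (meson Pow_iff finite_Pow_iff finite_subset subsetI)
  define I where "I \<Gamma> \<pi> = (if \<Gamma> \<subseteq> \<pi> then 1 else (0::real))" for \<Gamma> \<pi> :: "'a set"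
  have I: "(\<Sum>\<pi>\<in>S. I \<Gamma> \<pi>) = real (card {\<pi>\<in>S. \<Gamma> \<subseteq> \<pi>})" for \<Gamma>
    using fS by (simp add: I_def sum.inter_filter[symmetric])
  have pw: "(1 + s) ^ card (\<pi> \<inter> \<pi>') = (\<Sum>\<Gamma>\<in>Pow E. s ^ card \<Gamma> * (I \<Gamma> \<pi> * I \<Gamma> \<pi>'))"
    if "\<pi> \<in> S" "\<pi>' \<in> S" for \<pi> \<pi>'
  proof -
    have "finite (\<pi> \<inter> \<pi>')" using S(2) that E by (meson finite_Int finite_subset)
    hence "(1 + s) ^ card (\<pi> \<inter> \<pi>') = (\<Sum>\<Gamma>\<in>Pow (\<pi> \<inter> \<pi>'). s ^ card \<Gamma>)"
      by (rule sum_Pow_power_card[symmetric])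
    also have "\<dots> = (\<Sum>\<Gamma>\<in>Pow E. s ^ card \<Gamma> * (I \<Gamma> \<pi> * I \<Gamma> \<pi>'))"
      using E S(2) that by (intro sum.mono_neutral_cong_left) (auto simp: I_def)
    finally show ?thesis .
  qed
  have "(\<Sum>\<pi>\<in>S. \<Sum>\<pi>'\<in>S. (1 + s) ^ card (\<pi> \<inter> \<pi>')) =
      (\<Sum>\<pi>\<in>S. \<Sum>\<pi>'\<in>S. \<Sum>\<Gamma>\<in>Pow E. s ^ card \<Gamma> * (I \<Gamma> \<pi> * I \<Gamma> \<pi>'))"
    by (intro sum.cong refl pw)
  also have "\<dots> = (\<Sum>\<pi>\<in>S. \<Sum>\<Gamma>\<in>Pow E. \<Sum>\<pi>'\<in>S. s ^ card \<Gamma> * (I \<Gamma> \<pi> * I \<Gamma> \<pi>'))"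
    by (intro sum.cong refl sum.swap)
  also have "\<dots> = (\<Sum>\<Gamma>\<in>Pow E. \<Sum>\<pi>\<in>S. \<Sum>\<pi>'\<in>S. s ^ card \<Gamma> * (I \<Gamma> \<pi> * I \<Gamma> \<pi>'))"
    by (rule sum.swap)
  also have "\<dots> = (\<Sum>\<Gamma>\<in>Pow E. s ^ card \<Gamma> * (\<Sum>\<pi>\<in>S. I \<Gamma> \<pi>)\<^sup>2)"
    unfolding power2_eq_square sum_product by (simp only: sum_distrib_left)
  finally show ?thesis
    by (simp add: I P0_incl_eq[OF fS S(1)] power_divide sum_divide_distrib)
qed

text \<open>Deleting \<open>e\<close> and \<open>f\<close> is a bijection onto the subsets of the
  remaining edges, and each term loses exactly a factor \<open>t\<^sup>2\<close>. In the application
  \<open>t\<close> is of order \<open>p\<^sup>2\<close>, so this factor carries all the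
  smallness.\<close>

lemma sum_supersets_le:
  fixes t :: real
  assumes E: "finite E" and ef: "e \<in> E" "f \<in> E" "e \<noteq> f" and t: "0 \<le> t"
  shows "(\<Sum>\<Gamma>\<in>{\<Gamma>\<in>Pow E. e \<in> \<Gamma> \<and> f \<in> \<Gamma>}. t ^ card \<Gamma>) \<le> t\<^sup>2 * (1 + t) ^ card E"
proof -
  let ?R = "E - {e, f}"
  have img: "{\<Gamma>\<in>Pow E. e \<in> \<Gamma> \<and> f \<in> \<Gamma>} = (\<lambda>\<Delta>. \<Delta> \<union> {e, f}) ` Pow ?R" (is "?L = ?I")
  proof
    show "?L \<subseteq> ?I"
    proof
      fix \<Gamma> assume "\<Gamma> \<in> ?L"
      hence "\<Gamma> = (\<Gamma> - {e, f}) \<union> {e, f}" "\<Gamma> - {e, f} \<in> Pow ?R" by auto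
      thus "\<Gamma> \<in> ?I" by blast
    qed
  qed (use ef in auto)
  have "inj_on (\<lambda>\<Delta>. \<Delta> \<union> {e, f}) (Pow ?R)" by (auto simp: inj_on_def)
  hence "(\<Sum>\<Gamma>\<in>?L. t ^ card \<Gamma>) = (\<Sum>\<Delta>\<in>Pow ?R. t ^ card (\<Delta> \<union> {e, f}))"
    unfolding img by (simp add: sum.reindex)
  also have "\<dots> = (\<Sum>\<Delta>\<in>Pow ?R. t\<^sup>2 * t ^ card \<Delta>)"
  proof (intro sum.cong refl)
    fix \<Delta> assume \<Delta>: "\<Delta> \<in> Pow ?R"
    hence "finite \<Delta>" using E by (meson Pow_iff finite_Diff finite_subset)
    moreover have "\<Delta> \<inter> {e, f} = {}" using \<Delta> by auto
    ultimately have "card (\<Delta> \<union> {e, f}) = card \<Delta> + 2"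
      using ef(3) by (subst card_Un_disjoint) auto
    thus "t ^ card (\<Delta> \<union> {e, f}) = t\<^sup>2 * t ^ card \<Delta>" by (simp add: power_add power2_eq_square)
  qed
  also have "\<dots> = t\<^sup>2 * (1 + t) ^ card ?R"
    using E by (simp add: sum_distrib_left[symmetric] sum_Pow_power_card)
  also have "\<dots> \<le> t\<^sup>2 * (1 + t) ^ card E"
    using t E by (intro mult_left_mono power_increasing card_mono) auto
  finally show ?thesis .
qed

text \<open>Union bound over pairs of adjacent edges: a set that is not a matching contains two
  distinct edges \<open>{u, v}\<close> and \<open>{u, w}\<close>, and the triple of vertices
  determines the ordered pair, which leaves at most \<open>card V ^ 3\<close> pairs.\<close>

lemma sum_nonmatching_le:
  fixes t :: real
  assumes G: "simple_graph V E" and E: "finite E" and t: "0 \<le> t"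
  shows "(\<Sum>\<Gamma>\<in>{\<Gamma>\<in>Pow E. \<not> partial_matching E \<Gamma>}. t ^ card \<Gamma>) \<le>
    real (card V) ^ 3 * (t\<^sup>2 * (1 + t) ^ card E)"
proof -
  define A where "A = {(e, f). e \<in> E \<and> f \<in> E \<and> e \<noteq> f \<and> e \<inter> f \<noteq> {}}"
  have fA: "finite A" by (rule finite_subset[of _ "E \<times> E"]) (use E in \<open>auto simp: A_def\<close>)
  have fV: "finite V" and edge: "\<And>e. e \<in> E \<Longrightarrow> e \<subseteq> V \<and> card e = 2"
    using G by (auto simp: simple_graph_def)
  have star: "\<exists>v\<in>V. e = {u, v}" if "e \<in> E" "u \<in> e" for e u
    using edge[OF that(1)] that(2) by (auto simp: card_2_iff)
  have "A \<subseteq> (\<lambda>(u, v, w). ({u, v}, {u, w})) ` (V \<times> V \<times> V)"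
  proof
    fix z assume "z \<in> A"
    then obtain e f u where z: "z = (e, f)" "e \<in> E" "f \<in> E" "u \<in> e" "u \<in> f"
      by (auto simp: A_def)
    obtain v w where "v \<in> V" "w \<in> V" "e = {u, v}" "f = {u, w}" using star z by metis
    moreover have "u \<in> V" using edge z by auto
    ultimately have "(u, v, w) \<in> V \<times> V \<times> V" "z = (\<lambda>(u, v, w). ({u, v}, {u, w})) (u, v, w)"
      using z by auto
    thus "z \<in> (\<lambda>(u, v, w). ({u, v}, {u, w})) ` (V \<times> V \<times> V)" by blast
  qed
  hence "card A \<le> card (V \<times> V \<times> V)"
    using fV by (intro surj_card_le) auto
  hence "real (card A) \<le> real (card (V \<times> V \<times> V))" by (rule of_nat_mono)
  hence cA: "real (card A) \<le> real (card V) ^ 3"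
    by (simp add: card_cartesian_product power3_eq_cube mult.assoc)
  let ?N = "{\<Gamma>\<in>Pow E. \<not> partial_matching E \<Gamma>}"
  \<comment> \<open>The term of \<open>\<Gamma>\<close>, charged to a pair \<open>z\<close> of edges
    that both lie in \<open>\<Gamma>\<close>; every nonmatching is charged to at least one pair of
    \<open>A\<close>.\<close>
  let ?i = "\<lambda>z \<Gamma>. if fst z \<in> \<Gamma> \<and> snd z \<in> \<Gamma> then t ^ card \<Gamma> else 0"
  have "(\<Sum>\<Gamma>\<in>?N. t ^ card \<Gamma>) \<le> (\<Sum>\<Gamma>\<in>?N. \<Sum>z\<in>A. ?i z \<Gamma>)"
  proof (rule sum_mono)
    fix \<Gamma> assume \<Gamma>: "\<Gamma> \<in> ?N"
    then obtain e f where ef: "e \<in> \<Gamma>" "f \<in> \<Gamma>" "e \<noteq> f" "e \<inter> f \<noteq> {}"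
      by (auto simp: partial_matching_def pairwise_def disjnt_def)
    hence A: "(e, f) \<in> A" using \<Gamma> by (auto simp: A_def)
    have "?i (e, f) \<Gamma> \<le> (\<Sum>z\<in>A. ?i z \<Gamma>)"
      by (rule member_le_sum[OF A]) (use t fA in auto)
    thus "t ^ card \<Gamma> \<le> (\<Sum>z\<in>A. ?i z \<Gamma>)" using ef by simp
  qed
  also have "\<dots> = (\<Sum>z\<in>A. \<Sum>\<Gamma>\<in>?N. ?i z \<Gamma>)" by (rule sum.swap)
  also have "\<dots> \<le> (\<Sum>z\<in>A. t\<^sup>2 * (1 + t) ^ card E)"
  proof (rule sum_mono)
    fix z assume "z \<in> A"
    then obtain e f where z: "z = (e, f)" "e \<in> E" "f \<in> E" "e \<noteq> f" by (auto simp: A_def)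
    have "(\<Sum>\<Gamma>\<in>?N. ?i z \<Gamma>) \<le> (\<Sum>\<Gamma>\<in>Pow E. ?i z \<Gamma>)"
      by (rule sum_mono2) (use E t in auto)
    also have "\<dots> = (\<Sum>\<Gamma>\<in>{\<Gamma>\<in>Pow E. e \<in> \<Gamma> \<and> f \<in> \<Gamma>}. t ^ card \<Gamma>)"
      unfolding z using E by (subst sum.inter_filter) auto
    also have "\<dots> \<le> t\<^sup>2 * (1 + t) ^ card E"
      by (rule sum_supersets_le[OF E z(2,3,4) t])
    finally show "(\<Sum>\<Gamma>\<in>?N. ?i z \<Gamma>) \<le> t\<^sup>2 * (1 + t) ^ card E" .
  qed
  also have "\<dots> = real (card A) * (t\<^sup>2 * (1 + t) ^ card E)" by simp
  also have "\<dots> \<le> real (card V) ^ 3 * (t\<^sup>2 * (1 + t) ^ card E)"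
    using cA t by (intro mult_right_mono) auto
  finally show ?thesis .
qed

text \<open>The sum over \<open>\<Gamma>\<close> is split. On matchings, near-independence gives the
  main term \<open>(p\<^sup>2 * s) ^ k\<close>, whose sum is the second moment of \<open>X\<close>,
  plus an error of relative size \<open>1 / sqrt m\<close>. On other sets the crude bound gives
  \<open>t ^ k\<close>, and \<open>sum_nonmatching_le\<close> takes over.\<close>

lemma overlap_moment_le:
  fixes s p \<rho> :: real and m :: nat
  assumes G: "simple_graph V E" and S: "S \<noteq> {}" "\<And>\<pi>. \<pi> \<in> S \<Longrightarrow> \<pi> \<subseteq> E"
    and s: "0 \<le> s" and p: "0 < p" and \<rho>: "1 \<le> \<rho>" and m: "1 \<le> m"
    and edge: "\<And>e. e \<in> E \<Longrightarrow> P0_incl S {e} = p"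
    and matching: "\<And>\<Gamma>. partial_matching E \<Gamma> \<Longrightarrow>
      \<bar>P0_incl S \<Gamma> / (\<Prod>e\<in>\<Gamma>. P0_incl S {e}) - 1\<bar> \<le> \<rho> ^ card \<Gamma> / sqrt (real m)"
    and nonmatching: "\<And>\<Gamma>. \<Gamma> \<in> down_closure S \<Longrightarrow> \<not> partial_matching E \<Gamma> \<Longrightarrow>
      P0_incl S \<Gamma> \<le> \<rho> ^ card \<Gamma> * (\<Prod>e\<in>\<Gamma>. P0_incl S {e})"
  defines "t \<equiv> \<rho>\<^sup>2 * p\<^sup>2 * s"
  shows "(\<Sum>\<pi>\<in>S. \<Sum>\<pi>'\<in>S. (1 + s) ^ card (\<pi> \<inter> \<pi>')) / (real (card S))\<^sup>2 \<le>
    (1 + p\<^sup>2 * s) ^ card E + (3 / sqrt (real m) + real (card V) ^ 3 * t\<^sup>2) * (1 + t) ^ card E"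
proof -
  have "E \<subseteq> Pow V" "finite V" using G by (auto simp: simple_graph_def)
  hence E: "finite E" using finite_subset by blast
  have fS: "finite S" using S E by (meson Pow_iff finite_Pow_iff finite_subset subsetI)
  have t: "0 \<le> t" using s by (simp add: t_def)
  let ?r = "1 / sqrt (real m)"
  have r: "0 \<le> ?r" "?r \<le> 1" using m by auto
  have P_nonneg: "0 \<le> P0_incl S \<Gamma>" for \<Gamma> by (simp add: P0_incl_def)
  have prod_p: "(\<Prod>e\<in>\<Gamma>. P0_incl S {e}) = p ^ card \<Gamma>" if "\<Gamma> \<subseteq> E" for \<Gamma>
    using that edge by (simp add: subset_iff)
  have t_pow: "t ^ k = s ^ k * (\<rho> ^ k * p ^ k)\<^sup>2" for k
    by (simp add: t_def power_mult_distrib power_mult[symmetric] mult.commute mult.left_commute)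
  let ?F = "\<lambda>\<Gamma>. s ^ card \<Gamma> * (P0_incl S \<Gamma>)\<^sup>2"
  have bd1: "?F \<Gamma> \<le> (p\<^sup>2 * s) ^ card \<Gamma> + 3 * ?r * t ^ card \<Gamma>"
    if "partial_matching E \<Gamma>" for \<Gamma>
  proof -
    let ?k = "card \<Gamma>"
    have sub: "\<Gamma> \<subseteq> E" using that by (simp add: partial_matching_def)
    have "P0_incl S \<Gamma> / p ^ ?k \<le> 1 + \<rho> ^ ?k * ?r"
      using matching[OF that] by (simp add: prod_p[OF sub])
    hence "P0_incl S \<Gamma> \<le> (1 + \<rho> ^ ?k * ?r) * p ^ ?k"
      using p by (simp add: divide_le_eq)
    hence "(P0_incl S \<Gamma>)\<^sup>2 \<le> ((1 + \<rho> ^ ?k * ?r) * p ^ ?k)\<^sup>2"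
      using P_nonneg by (rule power_mono)
    also have "\<dots> = (1 + \<rho> ^ ?k * ?r)\<^sup>2 * (p ^ ?k)\<^sup>2" by (rule power_mult_distrib)
    \<comment> \<open>With \<open>a = \<rho> ^ k\<close> and \<open>r = 1 / sqrt m\<close>, both
      \<open>a * r\<close> and \<open>(a * r)\<^sup>2\<close> are at most
      \<open>a\<^sup>2 * r\<close>, because \<open>a \<ge> 1\<close> and \<open>r \<le> 1\<close>.
      The cross term counts twice, hence the constant 3.\<close>
    also have "(1 + \<rho> ^ ?k * ?r)\<^sup>2 \<le> 1 + 3 * ?r * (\<rho> ^ ?k)\<^sup>2"
    proof -
      define a where "a = \<rho> ^ ?k"
      have a: "1 \<le> a" using \<rho> by (simp add: a_def)
      hence aa: "a \<le> a\<^sup>2" by (simp add: power2_eq_square)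
      have "(a * ?r)\<^sup>2 = a\<^sup>2 * ?r * ?r" by (simp add: power2_eq_square)
      also have "\<dots> \<le> a\<^sup>2 * ?r * 1" using r by (intro mult_left_mono) auto
      finally have 1: "(a * ?r)\<^sup>2 \<le> a\<^sup>2 * ?r" by simp
      have 2: "a * ?r \<le> a\<^sup>2 * ?r" using aa r by (intro mult_right_mono) auto
      have "(1 + a * ?r)\<^sup>2 = 1 + 2 * (a * ?r) + (a * ?r)\<^sup>2" by (simp add: power2_sum)
      with 1 2 show ?thesis unfolding a_def[symmetric] by simp
    qed
    finally have "(P0_incl S \<Gamma>)\<^sup>2 \<le> (1 + 3 * ?r * (\<rho> ^ ?k)\<^sup>2) * (p ^ ?k)\<^sup>2"
      by (simp add: mult_right_mono)
    hence "?F \<Gamma> \<le> s ^ ?k * ((1 + 3 * ?r * (\<rho> ^ ?k)\<^sup>2) * (p ^ ?k)\<^sup>2)"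
      using s by (intro mult_left_mono) auto
    also have "\<dots> = (p\<^sup>2 * s) ^ ?k + 3 * ?r * t ^ ?k"
      by (simp add: t_pow power_mult_distrib power_mult[symmetric] algebra_simps)
    finally show ?thesis .
  qed
  have bd2: "?F \<Gamma> \<le> t ^ card \<Gamma>" if "\<Gamma> \<in> Pow E" "\<not> partial_matching E \<Gamma>" for \<Gamma>
  proof (cases "\<Gamma> \<in> down_closure S")
    case True
    have "P0_incl S \<Gamma> \<le> \<rho> ^ card \<Gamma> * p ^ card \<Gamma>"
      using nonmatching[OF True that(2)] that(1) prod_p by auto
    hence "(P0_incl S \<Gamma>)\<^sup>2 \<le> (\<rho> ^ card \<Gamma> * p ^ card \<Gamma>)\<^sup>2" using P_nonneg by (rule power_mono)
    thus ?thesis unfolding t_pow using s by (intro mult_left_mono) auto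
  next
    \<comment> \<open>Outside the down closure the assumed bound is silent, but no element of
      \<open>S\<close> contains \<open>\<Gamma>\<close>, so the inclusion probability is 0.\<close>
    case False
    hence "{\<pi>\<in>S. \<Gamma> \<subseteq> \<pi>} = {}" by (auto simp: down_closure_def)
    hence "P0_incl S \<Gamma> = 0" unfolding P0_incl_eq[OF fS S(1)] by (simp only: card.empty of_nat_0 div_0)
    thus ?thesis using t by simp
  qed
  have "?F \<Gamma> \<le> (p\<^sup>2 * s) ^ card \<Gamma> + 3 * ?r * t ^ card \<Gamma> +
      (if partial_matching E \<Gamma> then 0 else t ^ card \<Gamma>)" if "\<Gamma> \<in> Pow E" for \<Gamma>
  proof (cases "partial_matching E \<Gamma>")
    case True thus ?thesis using bd1 by simp
  next
    case False
    have "0 \<le> (p\<^sup>2 * s) ^ card \<Gamma> + 3 * ?r * t ^ card \<Gamma>"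
      using s t by (intro add_nonneg_nonneg mult_nonneg_nonneg) auto
    thus ?thesis using bd2[OF that False] False by simp
  qed
  hence "(\<Sum>\<Gamma>\<in>Pow E. ?F \<Gamma>) \<le> (\<Sum>\<Gamma>\<in>Pow E. (p\<^sup>2 * s) ^ card \<Gamma> + 3 * ?r * t ^ card \<Gamma> +
      (if partial_matching E \<Gamma> then 0 else t ^ card \<Gamma>))"
    by (rule sum_mono)
  also have "\<dots> = (1 + p\<^sup>2 * s) ^ card E + 3 * ?r * (1 + t) ^ card E +
      (\<Sum>\<Gamma>\<in>{\<Gamma>\<in>Pow E. \<not> partial_matching E \<Gamma>}. t ^ card \<Gamma>)"
  proof -
    have "(\<Sum>\<Gamma>\<in>Pow E. if partial_matching E \<Gamma> then 0 else t ^ card \<Gamma>) =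
        (\<Sum>\<Gamma>\<in>Pow E. if \<not> partial_matching E \<Gamma> then t ^ card \<Gamma> else 0)"
      by (intro sum.cong) auto
    also have "\<dots> = (\<Sum>\<Gamma>\<in>{\<Gamma>\<in>Pow E. \<not> partial_matching E \<Gamma>}. t ^ card \<Gamma>)"
      using E by (subst sum.inter_filter) auto
    finally show ?thesis
      by (simp only: sum.distrib sum_distrib_left[symmetric] sum_Pow_power_card[OF E])
  qed
  also have "\<dots> \<le> (1 + p\<^sup>2 * s) ^ card E + 3 * ?r * (1 + t) ^ card E +
      real (card V) ^ 3 * (t\<^sup>2 * (1 + t) ^ card E)"
    using sum_nonmatching_le[OF G E t] by simp
  finally have "(\<Sum>\<Gamma>\<in>Pow E. ?F \<Gamma>) \<le>
    (1 + p\<^sup>2 * s) ^ card E + (3 / sqrt (real m) + real (card V) ^ 3 * t\<^sup>2) * (1 + t) ^ card E"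
    by (simp add: algebra_simps)
  moreover have "(\<Sum>\<pi>\<in>S. \<Sum>\<pi>'\<in>S. (1 + s) ^ card (\<pi> \<inter> \<pi>')) / (real (card S))\<^sup>2 = (\<Sum>\<Gamma>\<in>Pow E. ?F \<Gamma>)"
    by (rule overlap_moment[OF E S])
  ultimately show ?thesis by simp
qed

text \<open>The expression bounds \<open>E (Zbar - X)\<^sup>2\<close>, expanded as a square. With
  \<open>r = m\<^sup>2 / N = N * p\<^sup>2 = m * p\<close>, the two powers of
  \<open>1 + p\<^sup>2 * s\<close> are at most \<open>exp (s * r)\<close>, and the cross term is at
  least \<open>exp (s * r - o(1))\<close>. As \<open>r\<close> converges, the exponentials cancel in
  the limit.\<close>

lemma overlap_error_tendsto_0:
  fixes N m :: "nat \<Rightarrow> nat" and v :: "nat \<Rightarrow> nat" and s \<rho> a :: real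
  assumes s: "0 \<le> s"
    and N: "filterlim (\<lambda>n. real (N n)) at_top sequentially"
    and m: "filterlim (\<lambda>n. real (m n)) at_top sequentially"
    and q: "(\<lambda>n. (real (m n))\<^sup>2 / real (N n)) \<longlonglongrightarrow> a"
    and p0: "(\<lambda>n. real (m n) / real (N n)) \<longlonglongrightarrow> 0"
    and v: "(\<lambda>n. real (v n) ^ 3 / (real (N n))\<^sup>2) \<longlonglongrightarrow> 0"
    and e: "\<epsilon> > 0"
  defines "p n \<equiv> real (m n) / real (N n)"
  defines "t n \<equiv> \<rho>\<^sup>2 * (p n)\<^sup>2 * s"
  shows "\<forall>\<^sub>F n in sequentially.
    (1 + (p n)\<^sup>2 * s) ^ N n + (3 / sqrt (real (m n)) + real (v n) ^ 3 * (t n)\<^sup>2) * (1 + t n) ^ N n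
      - 2 * (1 + p n * s) ^ m n + (1 + (p n)\<^sup>2 * s) ^ N n < \<epsilon>"
proof -
  define r where "r n = (real (m n))\<^sup>2 / real (N n)" for n
  \<comment> \<open>An explicit majorant that depends on \<open>n\<close> only through convergent
    quantities, so that its limit 0 can be read off.\<close>
  define b where "b n = 2 * exp (s * r n) - 2 * exp (s * r n - s\<^sup>2 * (p n * r n)) +
    (3 / sqrt (real (m n)) + (\<rho>\<^sup>2 * s * r n)\<^sup>2 * (real (v n) ^ 3 / (real (N n))\<^sup>2)) * exp (\<rho>\<^sup>2 * s * r n)"
    for n
  have q': "r \<longlonglongrightarrow> a" using q by (simp add: r_def[abs_def])
  have p': "p \<longlonglongrightarrow> 0" using p0 by (simp add: p_def[abs_def])
  have sm: "(\<lambda>n. 3 / sqrt (real (m n))) \<longlonglongrightarrow> 0"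
    by (intro real_tendsto_divide_at_top[OF tendsto_const] filterlim_compose[OF sqrt_at_top m])
  have "b \<longlonglongrightarrow> 2 * exp (s * a) - 2 * exp (s * a - s\<^sup>2 * (0 * a)) + (0 + (\<rho>\<^sup>2 * s * a)\<^sup>2 * 0) * exp (\<rho>\<^sup>2 * s * a)"
    unfolding b_def by (intro tendsto_intros q' p' sm v)
  hence "b \<longlonglongrightarrow> 0" by simp
  hence "\<forall>\<^sub>F n in sequentially. b n < \<epsilon>" using e by (rule order_tendstoD(2))
  moreover have "(\<lambda>n. p n * s) \<longlonglongrightarrow> 0 * s" by (intro tendsto_intros p')
  hence "\<forall>\<^sub>F n in sequentially. p n * s < 1" by (rule order_tendstoD(2)) simp
  moreover have "\<forall>\<^sub>F n in sequentially. 0 < real (N n)"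
    using N unfolding filterlim_at_top_dense by blast
  ultimately show ?thesis
  proof eventually_elim
    case (elim n)
    have p_nonneg: "0 \<le> p n" by (simp add: p_def)
    have Np: "real (N n) * (p n)\<^sup>2 = r n" and mp: "real (m n) * p n = r n"
      using elim(3) by (simp_all add: p_def r_def power2_eq_square)
    have le: "(1 + c * (p n)\<^sup>2) ^ N n \<le> exp (c * r n)" if "0 \<le> c" for c
    proof -
      have "(1 + c * (p n)\<^sup>2) ^ N n \<le> exp (c * (p n)\<^sup>2) ^ N n"
        using that by (intro power_mono exp_ge_add_one_self) auto
      also have "\<dots> = exp (c * r n)"
        by (simp add: exp_of_nat_mult[symmetric] Np[symmetric] mult.left_commute)
      finally show ?thesis .
    qed
    \<comment> \<open>From \<open>ln (1 + x) \<ge> x - x\<^sup>2\<close> on \<open>[0, 1]\<close>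
      with \<open>x = p * s\<close>; the loss \<open>m * x\<^sup>2 = s\<^sup>2 * p * r\<close>
      vanishes because \<open>p\<close> does.\<close>
    have ge: "exp (s * r n - s\<^sup>2 * (p n * r n)) \<le> (1 + p n * s) ^ m n"
    proof -
      have ps: "0 \<le> p n * s" "p n * s \<le> 1" using p_nonneg s elim(2) by auto
      have "s * r n - s\<^sup>2 * (p n * r n) = real (m n) * (p n * s - (p n * s)\<^sup>2)"
        by (simp add: mp[symmetric] power2_eq_square algebra_simps)
      also have "\<dots> \<le> real (m n) * ln (1 + p n * s)"
        using ln_one_plus_pos_lower_bound[OF ps] by (intro mult_left_mono) auto
      finally have "exp (s * r n - s\<^sup>2 * (p n * r n)) \<le> exp (real (m n) * ln (1 + p n * s))"
        by simp
      also have "\<dots> = (1 + p n * s) ^ m n" using ps by (simp add: exp_of_nat_mult)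
      finally show ?thesis .
    qed
    have "real (v n) ^ 3 * (t n)\<^sup>2 = (\<rho>\<^sup>2 * s * r n)\<^sup>2 * (real (v n) ^ 3 / (real (N n))\<^sup>2)"
      using elim(3) by (simp add: t_def Np[symmetric] power_mult_distrib)
    moreover have "(1 + (p n)\<^sup>2 * s) ^ N n \<le> exp (s * r n)"
      using le[OF s] by (simp add: mult.commute)
    moreover have "(1 + t n) ^ N n \<le> exp (\<rho>\<^sup>2 * s * r n)"
      using le[of "\<rho>\<^sup>2 * s"] s by (simp add: t_def ac_simps)
    ultimately have "(1 + (p n)\<^sup>2 * s) ^ N n +
      (3 / sqrt (real (m n)) + real (v n) ^ 3 * (t n)\<^sup>2) * (1 + t n) ^ N n
      - 2 * (1 + p n * s) ^ m n + (1 + (p n)\<^sup>2 * s) ^ N n \<le> b n"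
      unfolding b_def using ge mult_left_mono[of "(1 + t n) ^ N n" "exp (\<rho>\<^sup>2 * s * r n)"
        "3 / sqrt (real (m n)) + real (v n) ^ 3 * (t n)\<^sup>2"] by simp
    with elim(1) show ?case by simp
  qed
qed

section \<open>Boltzmann factors and the tilted law\<close>

lemma boltzmann_nonneg: "0 \<le> boltzmann \<beta> x"
  by (simp add: boltzmann_def)

lemma borel_measurable_boltzmann [measurable]: "boltzmann \<beta> \<in> borel_measurable borel"
  unfolding boltzmann_def[abs_def] by measurable

lemma real_total_weight:
  assumes "finite \<pi>" "\<And>e. e \<in> \<pi> \<Longrightarrow> \<bar>w e\<bar> \<noteq> \<infinity>"
  shows "total_weight w \<pi> = ereal (\<Sum>e\<in>\<pi>. real_of_ereal (w e))"
proof -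
  have "total_weight w \<pi> = (\<Sum>e\<in>\<pi>. ereal (real_of_ereal (w e)))"
    unfolding total_weight_def using assms by (intro sum.cong) (auto simp: ereal_real)
  thus ?thesis by simp
qed

lemma total_weight_eq_PInf:
  "finite \<pi> \<Longrightarrow> total_weight w \<pi> = \<infinity> \<longleftrightarrow> (\<exists>e\<in>\<pi>. w e = \<infinity>)"
  unfolding total_weight_def by (simp add: sum_Pinfty)

text \<open>Multiplicativity survives infinite weights, also at \<open>\<beta> = 0\<close>: one
  weight \<open>\<infinity>\<close> makes the total infinite and both sides 0. Without such a weight
  all weights are real and the exponential law applies.\<close>

lemma boltzmann_total_weight:
  assumes "finite \<pi>" "\<And>e. e \<in> \<pi> \<Longrightarrow> w e \<noteq> - \<infinity>"
  shows "boltzmann \<beta> (total_weight w \<pi>) = (\<Prod>e\<in>\<pi>. boltzmann \<beta> (w e))"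
proof (cases "\<exists>e\<in>\<pi>. w e = \<infinity>")
  case True
  hence "(\<Prod>e\<in>\<pi>. boltzmann \<beta> (w e)) = 0"
    using assms(1) by (auto simp: boltzmann_def)
  thus ?thesis using True assms(1) by (simp add: boltzmann_def total_weight_eq_PInf)
next
  case False
  hence "total_weight w \<pi> = ereal (\<Sum>e\<in>\<pi>. real_of_ereal (w e))"
    using assms by (intro real_total_weight) auto
  moreover have "(\<Prod>e\<in>\<pi>. boltzmann \<beta> (w e)) = (\<Prod>e\<in>\<pi>. exp (- \<beta> * real_of_ereal (w e)))"
    using False by (intro prod.cong) (auto simp: boltzmann_def)
  ultimately show ?thesis
    using assms(1) by (simp add: boltzmann_def exp_sum[symmetric] sum_distrib_left sum_negf)
qed

text \<open>As all elements of \<open>S\<close> have \<open>m\<close> edges, normalising each edge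
  factor by \<open>L\<close> pulls out the common constant \<open>L ^ m\<close>, which is
  \<open>E Z\<close> when \<open>L\<close> is the mean Boltzmann factor.\<close>

lemma partition_function_eq:
  fixes L :: real
  assumes "finite S" "\<And>\<pi>. \<pi> \<in> S \<Longrightarrow> finite \<pi> \<and> card \<pi> = m"
    and "\<And>\<pi> e. \<pi> \<in> S \<Longrightarrow> e \<in> \<pi> \<Longrightarrow> w e \<noteq> - \<infinity>" and "L \<noteq> 0"
  shows "partition_function S \<beta> w =
    L ^ m * ((\<Sum>\<pi>\<in>S. \<Prod>e\<in>\<pi>. boltzmann \<beta> (w e) / L) / real (card S))"
proof -
  have "boltzmann \<beta> (total_weight w \<pi>) = L ^ m * (\<Prod>e\<in>\<pi>. boltzmann \<beta> (w e) / L)" if "\<pi> \<in> S" for \<pi>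
    using assms(2-4) that by (subst boltzmann_total_weight) (auto simp: prod_dividef)
  thus ?thesis
    unfolding partition_function_def by (simp add: sum_distrib_left[symmetric])
qed

text \<open>This moves the mean from \<open>ereal\<close> to \<open>real\<close>. A set of infinite
  weight has Gibbs probability 0 and contributes \<open>\<infinity> * 0 = 0\<close>; on the real
  side its product of factors vanishes, so the value \<open>real_of_ereal \<infinity> = 0\<close>
  does no harm.\<close>

lemma gibbs_mean_eq:
  fixes L :: real
  assumes S: "finite S" "\<And>\<pi>. \<pi> \<in> S \<Longrightarrow> finite \<pi> \<and> card \<pi> = m"
    and w: "\<And>\<pi> e. \<pi> \<in> S \<Longrightarrow> e \<in> \<pi> \<Longrightarrow> w e \<noteq> - \<infinity>" and L: "0 < L"
    and Z: "(\<Sum>\<pi>\<in>S. \<Prod>e\<in>\<pi>. boltzmann \<beta> (w e) / L) / real (card S) = Z" "0 < Z"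
  shows "gibbs_mean S \<beta> w (total_weight w) = ereal ((\<Sum>\<pi>\<in>S. (\<Prod>e\<in>\<pi>. boltzmann \<beta> (w e) / L) *
    (\<Sum>e\<in>\<pi>. real_of_ereal (w e))) / (Z * real (card S)))"
proof -
  have pf: "partition_function S \<beta> w = L ^ m * Z"
    using partition_function_eq[OF S w, where L = L and \<beta> = \<beta>] L Z by auto
  have pf0: "partition_function S \<beta> w \<noteq> 0" using pf L Z(2) by simp
  have g: "gibbs S \<beta> w \<pi> = (\<Prod>e\<in>\<pi>. boltzmann \<beta> (w e) / L) / (Z * real (card S))" if "\<pi> \<in> S" for \<pi>
  proof -
    have "boltzmann \<beta> (total_weight w \<pi>) = L ^ m * (\<Prod>e\<in>\<pi>. boltzmann \<beta> (w e) / L)"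
      using S(2) w that L by (subst boltzmann_total_weight) (auto simp: prod_dividef)
    thus ?thesis using pf0 L by (simp add: gibbs_def pf)
  qed
  have "total_weight w \<pi> * ereal (gibbs S \<beta> w \<pi>) = ereal ((\<Prod>e\<in>\<pi>. boltzmann \<beta> (w e) / L) *
    (\<Sum>e\<in>\<pi>. real_of_ereal (w e)) / (Z * real (card S)))" if p: "\<pi> \<in> S" for \<pi>
  proof (cases "\<exists>e\<in>\<pi>. w e = \<infinity>")
    case True
    hence "(\<Prod>e\<in>\<pi>. boltzmann \<beta> (w e) / L) = 0" using S(2)[OF p] by (auto simp: boltzmann_def)
    thus ?thesis by (simp add: g[OF p] zero_ereal_def[symmetric])
  next
    case False
    hence "total_weight w \<pi> = ereal (\<Sum>e\<in>\<pi>. real_of_ereal (w e))"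
      using S(2) w p by (intro real_total_weight) auto
    thus ?thesis by (simp add: g[OF p])
  qed
  thus ?thesis unfolding gibbs_mean_def by (simp add: sum_divide_distrib)
qed

section \<open>Positivity of the Laplace transform and first moment of the tilted law\<close>

lemma expectation_boltzmann_pos:
  assumes "prob_space \<mu>" "sets \<mu> = sets borel" "measure \<mu> {\<infinity>} < 1" "integrable \<mu> (boltzmann \<beta>)"
  shows "0 < (\<integral>x. boltzmann \<beta> x \<partial>\<mu>)"
proof (rule ccontr)
  interpret prob_space \<mu> by fact
  assume "\<not> ?thesis"
  moreover have "0 \<le> (\<integral>x. boltzmann \<beta> x \<partial>\<mu>)" by (simp add: boltzmann_nonneg)
  ultimately have "(\<integral>x. boltzmann \<beta> x \<partial>\<mu>) = 0" by linarith
  hence "AE x in \<mu>. boltzmann \<beta> x = 0"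
    using integral_nonneg_eq_0_iff_AE[OF assms(4)] by (simp add: boltzmann_nonneg)
  hence "AE x in \<mu>. x \<in> {\<infinity>}" by eventually_elim (auto simp: boltzmann_def split: if_splits)
  moreover have "{\<infinity>} \<in> sets \<mu>" using assms(2) by simp
  ultimately have "prob {\<infinity>} = 1" by (subst prob_eq_1) auto
  with assms(3) show False by simp
qed

text \<open>Convexity of \<open>exp\<close> between 0 and \<open>- h * r\<close>, at the point a
  fraction \<open>h' / h\<close> along the way. The sign of \<open>r\<close> is arbitrary, so
  difference quotients increase as the step shrinks for negative and positive weights alike.\<close>

lemma exp_chord_quotient_mono:
  fixes r h h' :: real
  assumes "0 < h'" "h' \<le> h"
  shows "(1 - exp (- h * r)) / h \<le> (1 - exp (- h' * r)) / h'"
proof -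
  have "exp ((1 - h' / h) *\<^sub>R 0 + (h' / h) *\<^sub>R (- h * r)) \<le>
      (1 - h' / h) * exp 0 + (h' / h) * exp (- h * r)"
    using assms by (intro convex_onD[OF exp_convex]) (auto simp: field_simps)
  also have "(1 - h' / h) *\<^sub>R 0 + (h' / h) *\<^sub>R (- h * r) = - h' * r" using assms by simp
  finally have "(h' / h) * (1 - exp (- h * r)) \<le> 1 - exp (- h' * r)" by (simp add: algebra_simps)
  thus ?thesis using assms by (simp add: field_simps)
qed

lemma exp_quotient_tendsto:
  fixes r :: real
  assumes "h \<longlonglongrightarrow> 0" "\<And>k. h k \<noteq> 0"
  shows "(\<lambda>k. (1 - exp (- h k * r)) / h k) \<longlonglongrightarrow> r"
proof -
  have "((\<lambda>t. 1 - exp (- t * r)) has_real_derivative r) (at 0)"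
    by (auto intro!: derivative_eq_intros)
  hence "((\<lambda>t. (1 - exp (- t * r)) / t) \<longlongrightarrow> r) (at 0)"
    by (simp add: has_field_derivative_iff)
  moreover have "filterlim h (at 0) sequentially" using assms by (simp add: filterlim_at)
  ultimately show ?thesis by (rule filterlim_compose)
qed

text \<open>Only the right derivative is used, so that \<open>\<beta> = 0\<close>, where neither the integrability of the
  positive part of the weight nor a left derivative is available, needs no separate treatment.\<close>

lemma
  assumes \<mu>: "prob_space \<mu>" "sets \<mu> = sets borel" "measure \<mu> {\<infinity>} < 1"
    and int: "\<And>b. b \<ge> 0 \<Longrightarrow> integrable \<mu> (boltzmann b)"
    and \<beta>: "\<beta> \<ge> 0"
    and D: "(log_laplace \<mu> has_real_derivative D) (at \<beta> within {0..})"
  shows integrable_boltzmann_weight: "integrable \<mu> (\<lambda>x. boltzmann \<beta> x * real_of_ereal x)"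
    and expectation_boltzmann_weight:
      "(\<integral>x. boltzmann \<beta> x * real_of_ereal x \<partial>\<mu>) = - D * (\<integral>x. boltzmann \<beta> x \<partial>\<mu>)"
proof -
  define L where "L b = (\<integral>x. boltzmann b x \<partial>\<mu>)" for b
  define h where "h k = 1 / real (Suc k)" for k
  have h: "h \<longlonglongrightarrow> 0" "\<And>k. 0 < h k" "\<And>i j. i \<le> j \<Longrightarrow> h j \<le> h i"
    unfolding h_def by (rule LIMSEQ_Suc[OF lim_1_over_n]) (auto simp: frac_le)
  have Lpos: "0 < L b" if "b \<ge> 0" for b
    unfolding L_def by (rule expectation_boltzmann_pos[OF \<mu> int[OF that]])
  \<comment> \<open>Exponentiating turns differentiability of the logarithm into differentiability
    of the Laplace transform \<open>L\<close> itself.\<close>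
  have "((\<lambda>b. exp (log_laplace \<mu> b)) has_real_derivative (exp (log_laplace \<mu> \<beta>) * D)) (at \<beta> within {0..})"
    using D by (auto intro!: derivative_eq_intros)
  hence "((\<lambda>y. (exp (log_laplace \<mu> y) - exp (log_laplace \<mu> \<beta>)) / (y - \<beta>)) \<longlongrightarrow>
      exp (log_laplace \<mu> \<beta>) * D) (at \<beta> within {0..})"
    by (simp add: has_field_derivative_iff)
  moreover have "filterlim (\<lambda>k. \<beta> + h k) (at \<beta> within {0..}) sequentially"
    unfolding filterlim_at
  proof
    show "\<forall>\<^sub>F k in sequentially. \<beta> + h k \<in> {0..} \<and> \<beta> + h k \<noteq> \<beta>"
      using \<beta> h(2) by (intro always_eventually) (auto simp: less_imp_le less_imp_neq[THEN not_sym] add_nonneg_nonneg)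
    show "(\<lambda>k. \<beta> + h k) \<longlonglongrightarrow> \<beta>" using tendsto_add[OF tendsto_const[of \<beta>] h(1)] by simp
  qed
  ultimately have "(\<lambda>k. (exp (log_laplace \<mu> (\<beta> + h k)) - exp (log_laplace \<mu> \<beta>)) / (\<beta> + h k - \<beta>))
      \<longlonglongrightarrow> exp (log_laplace \<mu> \<beta>) * D"
    by (rule filterlim_compose)
  moreover have eL: "exp (log_laplace \<mu> b) = L b" if "b \<ge> 0" for b
    using Lpos[OF that] by (simp add: log_laplace_def L_def)
  ultimately have lim: "(\<lambda>k. (L (\<beta> + h k) - L \<beta>) / h k) \<longlonglongrightarrow> L \<beta> * D"
    using \<beta> h(2) by (simp add: add_nonneg_nonneg less_imp_le)
  define f where "f k x = (boltzmann \<beta> x - boltzmann (\<beta> + h k) x) / h k" for k x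
  \<comment> \<open>At \<open>x = \<infinity>\<close> both sides are 0, so infinite weights
    disappear from the pointwise monotonicity and the pointwise limit.\<close>
  have f_eq: "f k x = boltzmann \<beta> x * ((1 - exp (- h k * real_of_ereal x)) / h k)" for k x
    by (simp add: f_def boltzmann_def algebra_simps exp_add[symmetric])
  have fi: "integrable \<mu> (f k)" for k
    unfolding f_def using int \<beta> h(2)[of k] by auto
  have fe: "(\<integral>x. f k x \<partial>\<mu>) = - ((L (\<beta> + h k) - L \<beta>) / h k)" for k
    unfolding f_def L_def using int \<beta> h(2)[of k] by (simp add: minus_divide_left)
  have 1: "AE x in \<mu>. mono (\<lambda>k. f k x)"
    unfolding f_eq using h
    by (intro AE_I2 monoI mult_left_mono exp_chord_quotient_mono boltzmann_nonneg) auto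
  have 2: "AE x in \<mu>. (\<lambda>k. f k x) \<longlonglongrightarrow> boltzmann \<beta> x * real_of_ereal x"
    unfolding f_eq using h(2)
    by (intro AE_I2 tendsto_mult tendsto_const exp_quotient_tendsto h) (auto simp: less_imp_neq[THEN not_sym])
  have 3: "(\<lambda>k. \<integral>x. f k x \<partial>\<mu>) \<longlonglongrightarrow> - (L \<beta> * D)"
    unfolding fe by (rule tendsto_minus[OF lim])
  have 4: "(\<lambda>x. boltzmann \<beta> x * real_of_ereal x) \<in> borel_measurable \<mu>"
    unfolding measurable_cong_sets[OF \<mu>(2) refl] by measurable
  \<comment> \<open>Monotone convergence yields integrability of the limit from convergence of the
    integrals, which \<open>3\<close> derives from the existence of \<open>D\<close>.\<close>
  show "integrable \<mu> (\<lambda>x. boltzmann \<beta> x * real_of_ereal x)"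
    by (rule integrable_monotone_convergence[OF fi 1 2 3 4])
  show "(\<integral>x. boltzmann \<beta> x * real_of_ereal x \<partial>\<mu>) = - D * (\<integral>x. boltzmann \<beta> x \<partial>\<mu>)"
    using integral_monotone_convergence[OF fi 1 2 3 4] by (simp add: L_def)
qed

text \<open>Dominated convergence: at each point the error is eventually 0 as the level grows, and
  it never exceeds \<open>\<bar>g y * f y\<bar>\<close>.\<close>

lemma truncation_error_small:
  fixes f g :: "'a \<Rightarrow> real"
  assumes i: "integrable M (\<lambda>y. g y * f y)" and f: "f \<in> borel_measurable M"
    and g: "g \<in> borel_measurable M" "\<And>y. 0 \<le> g y" and e: "0 < \<epsilon>"
  shows "\<exists>K. (\<integral>y. g y * \<bar>f y - (if \<bar>f y\<bar> \<le> K then f y else 0)\<bar> \<partial>M) < \<epsilon>"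
proof -
  let ?s = "\<lambda>n y. g y * \<bar>f y - (if \<bar>f y\<bar> \<le> real n then f y else 0)\<bar>"
  have "(\<lambda>n. \<integral>y. ?s n y \<partial>M) \<longlonglongrightarrow> (\<integral>y. 0 \<partial>M)"
  proof (rule integral_dominated_convergence[where w = "\<lambda>y. \<bar>g y * f y\<bar>"])
    show "AE y in M. (\<lambda>n. ?s n y) \<longlonglongrightarrow> 0"
    proof (intro AE_I2)
      fix y
      have "\<forall>\<^sub>F n in sequentially. ?s n y = 0"
        by (rule eventually_sequentiallyI[of "nat \<lceil>\<bar>f y\<bar>\<rceil>"]) (auto simp: nat_le_iff ceiling_le_iff)
      thus "(\<lambda>n. ?s n y) \<longlonglongrightarrow> 0" by (rule tendsto_eventually)
    qed
    show "AE y in M. norm (?s n y) \<le> \<bar>g y * f y\<bar>" for n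
      using g(2) by (intro AE_I2) (auto simp: abs_mult)
  qed (use i f g in \<open>auto intro!: integrable_abs\<close>)
  hence "\<forall>\<^sub>F n in sequentially. (\<integral>y. ?s n y \<partial>M) < \<epsilon>" using e by (intro order_tendstoD(2)) auto
  then obtain n where "(\<integral>y. ?s n y \<partial>M) < \<epsilon>" by (auto dest: eventually_happens)
  thus ?thesis by blast
qed

section \<open>Moments of the normalised partition function\<close>

locale iid_family = prob_space M for M :: "'w measure" +
  fixes E :: "'e set" and \<omega> :: "'e \<Rightarrow> 'w \<Rightarrow> ereal" and \<mu> :: "ereal measure"
  assumes finite_E: "finite E"
    and prob_\<mu>: "prob_space \<mu>"
    and sets_\<mu>: "sets \<mu> = sets borel"
    and indep: "indep_vars (\<lambda>_. borel) \<omega> E"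
    and law: "\<And>e. e \<in> E \<Longrightarrow> distr M borel (\<omega> e) = \<mu>"
begin

lemma measurable_\<omega>: "e \<in> E \<Longrightarrow> \<omega> e \<in> borel_measurable M"
  using indep unfolding indep_vars_def by auto

lemma
  assumes "e \<in> E" "h \<in> borel_measurable borel"
  shows integrable_law: "integrable M (\<lambda>x. h (\<omega> e x)) \<longleftrightarrow> integrable \<mu> (h :: ereal \<Rightarrow> real)"
    and expectation_law: "expectation (\<lambda>x. h (\<omega> e x)) = (\<integral>y. h y \<partial>\<mu>)"
  using assms measurable_\<omega>[OF assms(1)]
  by (simp_all add: law[OF assms(1), symmetric] integrable_distr_eq integral_distr)

lemma
  fixes h :: "'e \<Rightarrow> ereal \<Rightarrow> real"
  assumes J: "J \<subseteq> E" and meas: "\<And>e. e \<in> J \<Longrightarrow> h e \<in> borel_measurable borel"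
    and int: "\<And>e. e \<in> J \<Longrightarrow> integrable \<mu> (h e)"
  shows expectation_prod: "expectation (\<lambda>x. \<Prod>e\<in>J. h e (\<omega> e x)) = (\<Prod>e\<in>J. \<integral>y. h e y \<partial>\<mu>)"
    and integrable_prod: "integrable M (\<lambda>x. \<Prod>e\<in>J. h e (\<omega> e x))"
proof -
  have fin: "finite J" using J finite_E finite_subset by blast
  have ind: "indep_vars (\<lambda>_. borel) (\<lambda>e x. h e (\<omega> e x)) J"
    by (rule indep_vars_compose2[OF indep_vars_subset[OF indep J]]) (use meas in auto)
  have int': "integrable M (\<lambda>x. h e (\<omega> e x))" if "e \<in> J" for e
    using that J meas int integrable_law by blast
  show "integrable M (\<lambda>x. \<Prod>e\<in>J. h e (\<omega> e x))"
    by (rule indep_vars_integrable[OF fin ind int'])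
  have "expectation (\<lambda>x. \<Prod>e\<in>J. h e (\<omega> e x)) = (\<Prod>e\<in>J. expectation (\<lambda>x. h e (\<omega> e x)))"
    by (rule indep_vars_lebesgue_integral[OF fin ind int'])
  also have "\<dots> = (\<Prod>e\<in>J. \<integral>y. h e y \<partial>\<mu>)"
    using J meas expectation_law by (intro prod.cong) auto
  finally show "expectation (\<lambda>x. \<Prod>e\<in>J. h e (\<omega> e x)) = (\<Prod>e\<in>J. \<integral>y. h e y \<partial>\<mu>)" .
qed

end

text \<open>The right side times \<open>1 + y\<close> is \<open>1 + y\<^sup>2 * (1 + 2 * y)\<close>.
  Keeping the exact linear term matters: it has mean 0 in the application, so only a second-order
  contribution remains.\<close>

lemma inverse_le_quadratic: "- 1/2 \<le> (y::real) \<Longrightarrow> 1 / (1 + y) \<le> 1 - y + 2 * y\<^sup>2"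
proof -
  assume y: "- 1/2 \<le> y"
  have "0 \<le> y\<^sup>2 * (1 + 2 * y)" using y by simp
  also have "\<dots> = (1 - y + 2 * y\<^sup>2) * (1 + y) - 1"
    by (simp add: algebra_simps power2_eq_square)
  finally show ?thesis using y by (simp add: divide_le_eq)
qed

text \<open>The theorem instantiates \<open>g\<close> with \<open>e\<^sup>-\<^sup>\<beta>\<^sup>x / E e\<^sup>-\<^sup>\<beta>\<^sup>\<omega>\<close>, so that \<open>g d\<mu>\<close> is the tilted law and
  \<open>Zbar\<close> is \<open>Z / E Z\<close>.\<close>

locale weighted_ensemble = iid_family M E \<omega> \<mu>
  for M :: "'w measure" and E :: "'e set" and \<omega> and \<mu> +
  fixes S :: "'e set set" and m :: nat and g :: "ereal \<Rightarrow> real" and s :: real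
  assumes S_ne: "S \<noteq> {}"
    and S_sub: "\<And>\<pi>. \<pi> \<in> S \<Longrightarrow> \<pi> \<subseteq> E"
    and S_card: "\<And>\<pi>. \<pi> \<in> S \<Longrightarrow> card \<pi> = m"
    and g_meas: "g \<in> borel_measurable borel"
    and g_nonneg: "\<And>y. 0 \<le> g y"
    and g_int: "integrable \<mu> g"
    and g_mean: "(\<integral>y. g y \<partial>\<mu>) = 1"
    and g2_int: "integrable \<mu> (\<lambda>y. (g y)\<^sup>2)"
    and g2_mean: "(\<integral>y. (g y)\<^sup>2 \<partial>\<mu>) = 1 + s"
begin

sublocale law: prob_space \<mu> by (rule prob_\<mu>)

definition Zbar :: "'w \<Rightarrow> real" where
  "Zbar x = (\<Sum>\<pi>\<in>S. \<Prod>e\<in>\<pi>. g (\<omega> e x)) / real (card S)"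

text \<open>The value of \<open>Zbar\<close> if the edges were included in \<open>\<pi>\<close> independently with probability \<open>p\<close>.\<close>

definition X :: "real \<Rightarrow> 'w \<Rightarrow> real" where
  "X p x = (\<Prod>e\<in>E. 1 + p * (g (\<omega> e x) - 1))"

lemma finite_S: "finite S"
  using S_sub finite_E by (meson Pow_iff finite_Pow_iff finite_subset subsetI)

lemma card_S_pos: "real (card S) > 0"
  using S_ne finite_S by (simp add: card_gt_0_iff)

lemma finite_mem_S: "\<pi> \<in> S \<Longrightarrow> finite \<pi>"
  using S_sub finite_E finite_subset by blast

lemma s_nonneg: "s \<ge> 0"
proof -
  have "0 \<le> (\<integral>y. (g y - 1)\<^sup>2 \<partial>\<mu>)" by simp
  also have "(\<integral>y. (g y - 1)\<^sup>2 \<partial>\<mu>) = (\<integral>y. (g y)\<^sup>2 - 2 * g y + 1 \<partial>\<mu>)"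
    by (simp add: power2_diff algebra_simps)
  also have "\<dots> = s"
    using g_int g2_int g_mean g2_mean by (simp add: law.prob_space)
  finally show ?thesis .
qed

lemma Zbar_nonneg: "0 \<le> Zbar x"
  unfolding Zbar_def by (intro divide_nonneg_nonneg sum_nonneg prod_nonneg) (auto simp: g_nonneg)

text \<open>Writing every product over the whole of \<open>E\<close> lets products over different
  edge sets be merged edge by edge, as \<open>expectation_prod\<close> requires.\<close>

lemma prod_extend: "\<pi> \<in> S \<Longrightarrow> (\<Prod>e\<in>\<pi>. f e) = (\<Prod>e\<in>E. if e \<in> \<pi> then f e else (1::real))"
  using prod.inter_restrict[OF finite_E, of f \<pi>] S_sub[of \<pi>] by (simp add: Int_absorb1)

lemma
  shows integrable_Zbar: "integrable M Zbar"
    and expectation_Zbar: "expectation Zbar = 1"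
proof -
  have i: "integrable M (\<lambda>x. \<Prod>e\<in>\<pi>. g (\<omega> e x))"
    and e: "expectation (\<lambda>x. \<Prod>e\<in>\<pi>. g (\<omega> e x)) = 1" if "\<pi> \<in> S" for \<pi>
    using expectation_prod[of \<pi> "\<lambda>_. g"] integrable_prod[of \<pi> "\<lambda>_. g"] S_sub[OF that]
    by (auto simp: g_meas g_int g_mean)
  show "integrable M Zbar" unfolding Zbar_def using i by auto
  show "expectation Zbar = 1" unfolding Zbar_def using i e card_S_pos by simp
qed

text \<open>By independence the mean of a pair product factorises: an edge in both sets gives
  \<open>E g\<^sup>2 = 1 + s\<close>, every other edge gives 1.\<close>

lemma
  shows integrable_Zbar_sq: "integrable M (\<lambda>x. (Zbar x)\<^sup>2)"
    and expectation_Zbar_sq: "expectation (\<lambda>x. (Zbar x)\<^sup>2) =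
      (\<Sum>\<pi>\<in>S. \<Sum>\<pi>'\<in>S. (1 + s) ^ card (\<pi> \<inter> \<pi>')) / (real (card S))\<^sup>2"
proof -
  define P where "P \<pi> \<pi>' x = (\<Prod>e\<in>\<pi>. g (\<omega> e x)) * (\<Prod>e\<in>\<pi>'. g (\<omega> e x))" for \<pi> \<pi>' x
  have ip: "integrable M (P \<pi> \<pi>') \<and> expectation (P \<pi> \<pi>') = (1 + s) ^ card (\<pi> \<inter> \<pi>')"
    if p: "\<pi> \<in> S" "\<pi>' \<in> S" for \<pi> \<pi>'
  proof -
    define h where "h e y = (if e \<in> \<pi> then g y else 1) * (if e \<in> \<pi>' then g y else 1)" for e y
    have P: "P \<pi> \<pi>' = (\<lambda>x. \<Prod>e\<in>E. h e (\<omega> e x))"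
      unfolding P_def h_def by (simp add: prod_extend[OF p(1)] prod_extend[OF p(2)] prod.distrib)
    have hm: "h e \<in> borel_measurable borel" for e
      unfolding h_def using g_meas by measurable
    have h_eq: "h e = (if e \<in> \<pi> \<inter> \<pi>' then (\<lambda>y. (g y)\<^sup>2) else if e \<in> \<pi> \<union> \<pi>' then g else (\<lambda>_. 1))" for e
      by (auto simp: h_def fun_eq_iff power2_eq_square)
    have hi: "integrable \<mu> (h e)" for e
      using g_int g2_int by (auto simp: h_eq)
    have he: "(\<integral>y. h e y \<partial>\<mu>) = (if e \<in> \<pi> \<inter> \<pi>' then 1 + s else 1)" for e
      using g_mean g2_mean by (auto simp: h_eq law.prob_space)
    have "(\<Prod>e\<in>E. if e \<in> \<pi> \<inter> \<pi>' then 1 + s else 1) = (\<Prod>e\<in>E \<inter> (\<pi> \<inter> \<pi>'). 1 + s)"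
      by (rule prod.inter_restrict[OF finite_E, symmetric])
    also have "E \<inter> (\<pi> \<inter> \<pi>') = \<pi> \<inter> \<pi>'" using S_sub p by auto
    finally show ?thesis
      using expectation_prod[OF order_refl hm hi] integrable_prod[OF order_refl hm hi]
      by (simp add: P he)
  qed
  have Z: "(Zbar x)\<^sup>2 = (\<Sum>\<pi>\<in>S. \<Sum>\<pi>'\<in>S. P \<pi> \<pi>' x) / (real (card S))\<^sup>2" for x
    unfolding Zbar_def P_def power_divide by (simp add: power2_eq_square sum_product)
  show "integrable M (\<lambda>x. (Zbar x)\<^sup>2)" unfolding Z using ip by auto
  show "expectation (\<lambda>x. (Zbar x)\<^sup>2) =
      (\<Sum>\<pi>\<in>S. \<Sum>\<pi>'\<in>S. (1 + s) ^ card (\<pi> \<inter> \<pi>')) / (real (card S))\<^sup>2"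
    unfolding Z using ip by simp
qed

text \<open>An edge of \<open>\<pi>\<close> contributes
  \<open>E ((1 + p * (g - 1)) * g) = 1 + p * s\<close>, an edge outside contributes 1. The mean is
  thus the same for every \<open>\<pi>\<close>, since each has \<open>m\<close> edges.\<close>

lemma
  shows integrable_X_Zbar: "integrable M (\<lambda>x. X p x * Zbar x)"
    and expectation_X_Zbar: "expectation (\<lambda>x. X p x * Zbar x) = (1 + p * s) ^ m"
proof -
  define P where "P \<pi> x = X p x * (\<Prod>e\<in>\<pi>. g (\<omega> e x))" for \<pi> x
  have ip: "integrable M (P \<pi>) \<and> expectation (P \<pi>) = (1 + p * s) ^ m"
    if p: "\<pi> \<in> S" for \<pi>
  proof -
    define h where "h e y = (1 + p * (g y - 1)) * (if e \<in> \<pi> then g y else 1)" for e y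
    have P: "P \<pi> = (\<lambda>x. \<Prod>e\<in>E. h e (\<omega> e x))"
      unfolding P_def h_def X_def by (simp add: prod_extend[OF p] prod.distrib)
    have hm: "h e \<in> borel_measurable borel" for e
      unfolding h_def using g_meas by measurable
    have h_eq: "h e = (if e \<in> \<pi> then (\<lambda>y. (1 - p) * g y + p * (g y)\<^sup>2)
        else (\<lambda>y. 1 - p + p * g y))" for e
      by (auto simp: h_def fun_eq_iff power2_eq_square algebra_simps)
    have hi: "integrable \<mu> (h e)" for e
      using g_int g2_int by (auto simp: h_eq)
    have he: "(\<integral>y. h e y \<partial>\<mu>) = (if e \<in> \<pi> then 1 + p * s else 1)" for e
      using g_mean g2_mean g_int g2_int by (auto simp: h_eq law.prob_space algebra_simps)
    have "(\<Prod>e\<in>E. if e \<in> \<pi> then 1 + p * s else 1) = (\<Prod>e\<in>E \<inter> \<pi>. 1 + p * s)"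
      by (rule prod.inter_restrict[OF finite_E, symmetric])
    also have "E \<inter> \<pi> = \<pi>" using S_sub p by auto
    finally show ?thesis
      using expectation_prod[OF order_refl hm hi] integrable_prod[OF order_refl hm hi] S_card[OF p]
      by (simp add: P he)
  qed
  have Z: "X p x * Zbar x = (\<Sum>\<pi>\<in>S. P \<pi> x) / real (card S)" for x
    unfolding Zbar_def P_def by (simp add: sum_distrib_left)
  show "integrable M (\<lambda>x. X p x * Zbar x)" unfolding Z using ip by auto
  show "expectation (\<lambda>x. X p x * Zbar x) = (1 + p * s) ^ m"
    unfolding Z using ip card_S_pos by simp
qed

lemma
  shows integrable_X_sq: "integrable M (\<lambda>x. (X p x)\<^sup>2)"
    and expectation_X_sq: "expectation (\<lambda>x. (X p x)\<^sup>2) = (1 + p\<^sup>2 * s) ^ card E"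
proof -
  define h where "h y = (1 + p * (g y - 1))\<^sup>2" for y
  have h_eq: "h = (\<lambda>y. (1 - p)\<^sup>2 + 2 * p * (1 - p) * g y + p\<^sup>2 * (g y)\<^sup>2)"
    by (auto simp: h_def fun_eq_iff power2_eq_square algebra_simps)
  have hm: "h \<in> borel_measurable borel" unfolding h_def using g_meas by measurable
  have hi: "integrable \<mu> h" using g_int g2_int by (auto simp: h_eq)
  have he: "(\<integral>y. h y \<partial>\<mu>) = 1 + p\<^sup>2 * s"
    using g_mean g2_mean g_int g2_int
    by (auto simp: h_eq law.prob_space algebra_simps power2_eq_square)
  have X: "(X p x)\<^sup>2 = (\<Prod>e\<in>E. h (\<omega> e x))" for x
    by (simp add: X_def h_def prod_power_distrib)
  show "integrable M (\<lambda>x. (X p x)\<^sup>2)"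
    unfolding X by (rule integrable_prod[OF order_refl]) (auto simp: hm hi)
  show "expectation (\<lambda>x. (X p x)\<^sup>2) = (1 + p\<^sup>2 * s) ^ card E"
    unfolding X by (subst expectation_prod[OF order_refl]) (auto simp: hm hi he)
qed

section \<open>Lower tail of \<open>Zbar\<close> through the inverse moment of
  \<open>X\<close>\<close>

lemma X_pos: "0 \<le> p \<Longrightarrow> p \<le> 1/2 \<Longrightarrow> 0 < X p x"
  unfolding X_def
proof (intro prod_pos ballI)
  fix e assume p: "0 \<le> p" "p \<le> 1/2"
  have "0 \<le> p * g (\<omega> e x)" using p g_nonneg by simp
  thus "0 < 1 + p * (g (\<omega> e x) - 1)" using p by (simp add: algebra_simps)
qed

text \<open>Since \<open>g \<ge> 0\<close> and \<open>p \<le> 1/2\<close>, the increment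
  \<open>p * (g - 1)\<close> is at least \<open>- 1/2\<close> and
  \<open>inverse_le_quadratic\<close> applies on each edge. The linear term integrates to 0 and the
  quadratic one to \<open>2 * p\<^sup>2 * s\<close>.\<close>

lemma
  assumes p: "0 \<le> p" "p \<le> 1/2"
  shows integrable_inverse_X: "integrable M (\<lambda>x. 1 / X p x)"
    and expectation_inverse_X: "expectation (\<lambda>x. 1 / X p x) \<le> (1 + 2 * p\<^sup>2 * s) ^ card E"
proof -
  define h where "h y = 1 / (1 + p * (g y - 1))" for y
  have lo: "- 1/2 \<le> p * (g y - 1)" for y
  proof -
    have "0 \<le> p * g y" using p g_nonneg by simp
    thus ?thesis using p by (simp add: algebra_simps)
  qed
  have h0: "0 \<le> h y" for y unfolding h_def using lo[of y] by (simp add: field_simps)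
  have hm: "h \<in> borel_measurable borel" unfolding h_def using g_meas by measurable
  define k where "k y = 1 - p * (g y - 1) + 2 * (p * (g y - 1))\<^sup>2" for y
  have k_eq: "k = (\<lambda>y. 1 + p + 2 * p\<^sup>2 + (- p - 4 * p\<^sup>2) * g y + 2 * p\<^sup>2 * (g y)\<^sup>2)"
    by (auto simp: k_def fun_eq_iff power2_eq_square algebra_simps)
  have ki: "integrable \<mu> k" using g_int g2_int by (auto simp: k_eq)
  have "(\<integral>y. k y \<partial>\<mu>) = 1 + p + 2 * p\<^sup>2 + (- p - 4 * p\<^sup>2) * 1 + 2 * p\<^sup>2 * (1 + s)"
    using g_mean g2_mean g_int g2_int by (simp add: k_eq law.prob_space)
  hence ke: "(\<integral>y. k y \<partial>\<mu>) = 1 + 2 * p\<^sup>2 * s" by (simp add: algebra_simps)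
  have hk: "h y \<le> k y" for y
    unfolding h_def k_def by (rule inverse_le_quadratic[OF lo])
  have hi: "integrable \<mu> h"
    by (rule Bochner_Integration.integrable_bound[OF ki])
       (use hm hk h0 order_trans[OF hk abs_ge_self] in
         \<open>auto simp: measurable_cong_sets[OF sets_\<mu> refl]\<close>)
  have he: "(\<integral>y. h y \<partial>\<mu>) \<le> 1 + 2 * p\<^sup>2 * s"
    unfolding ke[symmetric] by (rule integral_mono[OF hi ki hk])
  have X: "1 / X p x = (\<Prod>e\<in>E. h (\<omega> e x))" for x
    by (simp add: X_def h_def prod_dividef)
  show "integrable M (\<lambda>x. 1 / X p x)"
    unfolding X by (rule integrable_prod[OF order_refl]) (auto simp: hm hi)
  have "expectation (\<lambda>x. 1 / X p x) = (\<integral>y. h y \<partial>\<mu>) ^ card E"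
    unfolding X by (subst expectation_prod[OF order_refl]) (auto simp: hm hi)
  also have "\<dots> \<le> (1 + 2 * p\<^sup>2 * s) ^ card E"
    by (rule power_mono[OF he]) (simp add: h0)
  finally show "expectation (\<lambda>x. 1 / X p x) \<le> (1 + 2 * p\<^sup>2 * s) ^ card E" .
qed

text \<open>If \<open>Zbar < \<delta>\<close>, then either \<open>X < 2 * \<delta>\<close>,
  controlled by Markov's inequality for \<open>1 / X\<close>, or \<open>Zbar\<close> and
  \<open>X\<close> differ by at least \<open>\<delta>\<close>, controlled by Markov's inequality for
  the squared difference.\<close>

lemma prob_Zbar_less:
  assumes p: "0 \<le> p" "p \<le> 1/2" and d: "\<delta> > 0"
  shows "prob {x \<in> space M. Zbar x < \<delta>} \<le>
    2 * \<delta> * (1 + 2 * p\<^sup>2 * s) ^ card E +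
    ((\<Sum>\<pi>\<in>S. \<Sum>\<pi>'\<in>S. (1 + s) ^ card (\<pi> \<inter> \<pi>')) / (real (card S))\<^sup>2
      - 2 * (1 + p * s) ^ m + (1 + p\<^sup>2 * s) ^ card E) / \<delta>\<^sup>2"
proof -
  let ?A = "{x \<in> space M. 1 / X p x \<ge> 1 / (2 * \<delta>)}"
  let ?B = "{x \<in> space M. (Zbar x - X p x)\<^sup>2 \<ge> \<delta>\<^sup>2}"
  have sq: "(Zbar x - X p x)\<^sup>2 = (Zbar x)\<^sup>2 - 2 * (X p x * Zbar x) + (X p x)\<^sup>2" for x
    by (simp add: power2_eq_square algebra_simps)
  have iB: "integrable M (\<lambda>x. (Zbar x - X p x)\<^sup>2)"
    unfolding sq using integrable_Zbar_sq integrable_X_Zbar integrable_X_sq by auto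
  have eB: "expectation (\<lambda>x. (Zbar x - X p x)\<^sup>2) =
    (\<Sum>\<pi>\<in>S. \<Sum>\<pi>'\<in>S. (1 + s) ^ card (\<pi> \<inter> \<pi>')) / (real (card S))\<^sup>2
      - 2 * (1 + p * s) ^ m + (1 + p\<^sup>2 * s) ^ card E"
    unfolding sq using integrable_Zbar_sq integrable_X_Zbar integrable_X_sq
    by (simp add: expectation_Zbar_sq expectation_X_Zbar expectation_X_sq)
  note iA = integrable_inverse_X[OF p]
  have A: "?A \<in> events" and B: "?B \<in> events"
    using borel_measurable_integrable[OF iA] borel_measurable_integrable[OF iB] by measurable
  have "{x \<in> space M. Zbar x < \<delta>} \<subseteq> ?A \<union> ?B"
  proof safe
    fix x assume x: "x \<in> space M" "Zbar x < \<delta>" "\<not> (Zbar x - X p x)\<^sup>2 \<ge> \<delta>\<^sup>2"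
    have "\<bar>Zbar x - X p x\<bar> < \<delta>"
      using x(3) d by (metis abs_le_square_iff abs_of_pos not_le)
    hence "X p x < 2 * \<delta>" using x(2) by linarith
    thus "1 / X p x \<ge> 1 / (2 * \<delta>)" using X_pos[OF p, of x] d by (simp add: frac_le)
  qed
  hence "prob {x \<in> space M. Zbar x < \<delta>} \<le> prob (?A \<union> ?B)"
    using A B by (intro finite_measure_mono) auto
  also have "\<dots> \<le> prob ?A + prob ?B" by (rule measure_Un_le[OF A B])
  also have "prob ?A \<le> expectation (\<lambda>x. 1 / X p x) / (1 / (2 * \<delta>))"
    by (rule integral_Markov_inequality_measure[OF iA sets.empty_sets])
       (use d X_pos[OF p] in \<open>auto simp: less_imp_le\<close>)
  also have "\<dots> \<le> 2 * \<delta> * (1 + 2 * p\<^sup>2 * s) ^ card E"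
    using mult_left_mono[OF expectation_inverse_X[OF p], of "2 * \<delta>"] d by (simp add: algebra_simps)
  also have "prob ?B \<le> expectation (\<lambda>x. (Zbar x - X p x)\<^sup>2) / \<delta>\<^sup>2"
    by (rule integral_Markov_inequality_measure[OF iB sets.empty_sets]) (use d in auto)
  finally show ?thesis unfolding eB by simp
qed

end

section \<open>Law of large numbers under the tilted law\<close>

context weighted_ensemble
begin

text \<open>Change of measure: the product over \<open>\<pi>\<close> is a density that gives each
  weight on \<open>\<pi>\<close> the law \<open>g d\<mu>\<close>. The factors of the edges other
  than \<open>e\<close> integrate to 1.\<close>

lemma
  assumes \<pi>: "\<pi> \<in> S" and e: "e \<in> \<pi>"
    and h: "h \<in> borel_measurable borel" "integrable \<mu> (\<lambda>y. g y * h y)"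
  shows integrable_tilted: "integrable M (\<lambda>x. (\<Prod>e\<in>\<pi>. g (\<omega> e x)) * h (\<omega> e x))"
    and expectation_tilted:
      "expectation (\<lambda>x. (\<Prod>e\<in>\<pi>. g (\<omega> e x)) * h (\<omega> e x)) = (\<integral>y. g y * h y \<partial>\<mu>)"
proof -
  \<comment> \<open>Absorbing \<open>h\<close> into the factor of \<open>e\<close> leaves a product
    of functions of single weights.\<close>
  define k where "k e' y = g y * (if e' = e then h y else 1)" for e' y
  have fin: "finite \<pi>" by (rule finite_mem_S[OF \<pi>])
  have P: "(\<Prod>e\<in>\<pi>. g (\<omega> e x)) * h (\<omega> e x) = (\<Prod>e'\<in>\<pi>. k e' (\<omega> e' x))" for x
    using fin e by (simp add: k_def prod.distrib prod.delta)
  have km: "k e' \<in> borel_measurable borel" for e' unfolding k_def using g_meas h by measurable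
  have k_eq: "k e' = (if e' = e then (\<lambda>y. g y * h y) else g)" for e' by (auto simp: k_def)
  have ki: "integrable \<mu> (k e')" for e' using g_int h by (simp add: k_eq)
  have ke: "(\<integral>y. k e' y \<partial>\<mu>) = (if e' = e then \<integral>y. g y * h y \<partial>\<mu> else 1)" for e'
    using g_mean by (simp add: k_eq)
  show "integrable M (\<lambda>x. (\<Prod>e\<in>\<pi>. g (\<omega> e x)) * h (\<omega> e x))"
    unfolding P by (rule integrable_prod[OF S_sub[OF \<pi>] km ki])
  show "expectation (\<lambda>x. (\<Prod>e\<in>\<pi>. g (\<omega> e x)) * h (\<omega> e x)) = (\<integral>y. g y * h y \<partial>\<mu>)"
    unfolding P expectation_prod[OF S_sub[OF \<pi>] km ki] ke using fin e by (simp add: prod.delta)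
qed

text \<open>Weights on distinct edges of \<open>\<pi>\<close> remain independent under the tilted
  law, so the mixed moment is a product of two equal means.\<close>

lemma
  assumes \<pi>: "\<pi> \<in> S" and ef: "e \<in> \<pi>" "f \<in> \<pi>" "e \<noteq> f"
    and h: "h \<in> borel_measurable borel" "integrable \<mu> (\<lambda>y. g y * h y)"
  shows integrable_tilted2: "integrable M (\<lambda>x. (\<Prod>e\<in>\<pi>. g (\<omega> e x)) * (h (\<omega> e x) * h (\<omega> f x)))"
    and expectation_tilted2:
      "expectation (\<lambda>x. (\<Prod>e\<in>\<pi>. g (\<omega> e x)) * (h (\<omega> e x) * h (\<omega> f x))) =
        (\<integral>y. g y * h y \<partial>\<mu>)\<^sup>2"
proof -
  define k where "k e' y = g y * ((if e' = e then h y else 1) * (if e' = f then h y else 1))" for e' y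
  have fin: "finite \<pi>" by (rule finite_mem_S[OF \<pi>])
  have P: "(\<Prod>e\<in>\<pi>. g (\<omega> e x)) * (h (\<omega> e x) * h (\<omega> f x)) = (\<Prod>e'\<in>\<pi>. k e' (\<omega> e' x))" for x
    using fin ef by (simp add: k_def prod.distrib prod.delta)
  have km: "k e' \<in> borel_measurable borel" for e' unfolding k_def using g_meas h by measurable
  have k_eq: "k e' = (if e' = e \<or> e' = f then (\<lambda>y. g y * h y) else g)" for e'
    using ef by (auto simp: k_def)
  have ki: "integrable \<mu> (k e')" for e' using g_int h by (simp add: k_eq)
  have ke: "(\<integral>y. k e' y \<partial>\<mu>) = (if e' = e then \<integral>y. g y * h y \<partial>\<mu> else 1) *
      (if e' = f then \<integral>y. g y * h y \<partial>\<mu> else 1)" for e'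
    using g_mean ef by (simp add: k_eq)
  show "integrable M (\<lambda>x. (\<Prod>e\<in>\<pi>. g (\<omega> e x)) * (h (\<omega> e x) * h (\<omega> f x)))"
    unfolding P by (rule integrable_prod[OF S_sub[OF \<pi>] km ki])
  show "expectation (\<lambda>x. (\<Prod>e\<in>\<pi>. g (\<omega> e x)) * (h (\<omega> e x) * h (\<omega> f x))) =
      (\<integral>y. g y * h y \<partial>\<mu>)\<^sup>2"
    unfolding P expectation_prod[OF S_sub[OF \<pi>] km ki] ke
    using fin ef by (simp add: prod.delta prod.distrib power2_eq_square)
qed

lemma integrable_g_bounded:
  assumes "u \<in> borel_measurable borel" "\<And>y. \<bar>u y\<bar> \<le> K"
  shows "integrable \<mu> (\<lambda>y. g y * u y)"
proof (rule Bochner_Integration.integrable_bound)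
  show "integrable \<mu> (\<lambda>y. K * g y)" using g_int by simp
  show "(\<lambda>y. g y * u y) \<in> borel_measurable \<mu>"
    using assms(1) g_meas by (simp add: measurable_cong_sets[OF sets_\<mu> refl])
  have "g y * \<bar>u y\<bar> \<le> \<bar>K\<bar> * g y" for y
    using mult_right_mono[OF order_trans[OF assms(2)[of y] abs_ge_self] g_nonneg[of y]]
    by (simp add: mult.commute)
  thus "AE y in \<mu>. norm (g y * u y) \<le> norm (K * g y)"
    by (intro AE_I2) (auto simp: abs_mult g_nonneg)
qed

text \<open>The variance of a sum of \<open>m\<close> independent centred variables under the tilted
  law: off-diagonal terms vanish because \<open>u\<close> has tilted mean 0, and each diagonal term
  is at most \<open>K\<^sup>2\<close>.\<close>

lemma
  assumes \<pi>: "\<pi> \<in> S" and u: "u \<in> borel_measurable borel" "\<And>y. \<bar>u y\<bar> \<le> K"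
    and c: "(\<integral>y. g y * u y \<partial>\<mu>) = 0"
  shows integrable_tilted_square:
      "integrable M (\<lambda>x. (\<Prod>e\<in>\<pi>. g (\<omega> e x)) * (\<Sum>e\<in>\<pi>. u (\<omega> e x))\<^sup>2)"
    and expectation_tilted_square_le:
      "expectation (\<lambda>x. (\<Prod>e\<in>\<pi>. g (\<omega> e x)) * (\<Sum>e\<in>\<pi>. u (\<omega> e x))\<^sup>2) \<le> real m * K\<^sup>2"
proof -
  have fin: "finite \<pi>" by (rule finite_mem_S[OF \<pi>])
  have K: "\<bar>u y * u y\<bar> \<le> K\<^sup>2" for y
    using mult_mono[OF u(2)[of y] u(2)[of y]] u(2)[of y] by (simp add: abs_mult power2_eq_square)
  have u2: "(\<lambda>y. u y * u y) \<in> borel_measurable borel" using u(1) by simp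
  note iu = integrable_g_bounded[OF u] and iu2 = integrable_g_bounded[OF u2 K]
  have le: "(\<integral>y. g y * (u y * u y) \<partial>\<mu>) \<le> K\<^sup>2"
  proof -
    have "(\<integral>y. g y * (u y * u y) \<partial>\<mu>) \<le> (\<integral>y. g y * K\<^sup>2 \<partial>\<mu>)"
      using iu2 g_int K g_nonneg by (intro integral_mono mult_left_mono) (auto intro: order_trans[OF abs_ge_self])
    thus ?thesis using g_mean by simp
  qed
  let ?T = "\<lambda>e f x. (\<Prod>e\<in>\<pi>. g (\<omega> e x)) * (u (\<omega> e x) * u (\<omega> f x))"
  have T: "integrable M (?T e f) \<and> expectation (?T e f) \<le> (if e = f then K\<^sup>2 else 0)"
    if "e \<in> \<pi>" "f \<in> \<pi>" for e f
    using integrable_tilted[OF \<pi> that(1) u2 iu2] expectation_tilted[OF \<pi> that(1) u2 iu2] le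
      integrable_tilted2[OF \<pi> that _ u(1) iu] expectation_tilted2[OF \<pi> that _ u(1) iu] c
    by (cases "e = f") auto
  have sq: "(\<Prod>e\<in>\<pi>. g (\<omega> e x)) * (\<Sum>e\<in>\<pi>. u (\<omega> e x))\<^sup>2 = (\<Sum>e\<in>\<pi>. \<Sum>f\<in>\<pi>. ?T e f x)" for x
    unfolding power2_eq_square sum_product by (simp only: sum_distrib_left)
  show "integrable M (\<lambda>x. (\<Prod>e\<in>\<pi>. g (\<omega> e x)) * (\<Sum>e\<in>\<pi>. u (\<omega> e x))\<^sup>2)"
    unfolding sq using T by (intro Bochner_Integration.integrable_sum) auto
  have "expectation (\<lambda>x. (\<Prod>e\<in>\<pi>. g (\<omega> e x)) * (\<Sum>e\<in>\<pi>. u (\<omega> e x))\<^sup>2) =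
      (\<Sum>e\<in>\<pi>. \<Sum>f\<in>\<pi>. expectation (?T e f))"
    unfolding sq using T by (subst Bochner_Integration.integral_sum; (intro sum.cong refl Bochner_Integration.integrable_sum Bochner_Integration.integral_sum)?) auto
  also have "\<dots> \<le> (\<Sum>e\<in>\<pi>. \<Sum>f\<in>\<pi>. if e = f then K\<^sup>2 else 0)"
    using T by (intro sum_mono) auto
  also have "\<dots> = real m * K\<^sup>2" using fin S_card[OF \<pi>] by simp
  finally show "expectation (\<lambda>x. (\<Prod>e\<in>\<pi>. g (\<omega> e x)) * (\<Sum>e\<in>\<pi>. u (\<omega> e x))\<^sup>2) \<le> real m * K\<^sup>2" .
qed

text \<open>The weak law of large numbers under the tilted law, for a merely integrable \<open>f\<close> and with a rate
  depending only on the truncation \<open>k\<close>; the first term uses \<open>\<bar>U\<bar> \<le> U\<^sup>2 / \<theta> + \<theta>\<close>.\<close>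

lemma
  assumes \<pi>: "\<pi> \<in> S"
    and f: "f \<in> borel_measurable borel" "integrable \<mu> (\<lambda>y. g y * f y)" "(\<integral>y. g y * f y \<partial>\<mu>) = a"
    and k: "k \<in> borel_measurable borel" "\<And>y. \<bar>k y\<bar> \<le> K"
    and \<theta>: "0 < \<theta>"
  shows integrable_tilted_deviation:
      "integrable M (\<lambda>x. (\<Prod>e\<in>\<pi>. g (\<omega> e x)) * \<bar>\<Sum>e\<in>\<pi>. f (\<omega> e x) - a\<bar>)"
    and expectation_tilted_deviation_le:
      "expectation (\<lambda>x. (\<Prod>e\<in>\<pi>. g (\<omega> e x)) * \<bar>\<Sum>e\<in>\<pi>. f (\<omega> e x) - a\<bar>) \<le>
        real m * (2 * K)\<^sup>2 / \<theta> + \<theta> + 2 * real m * (\<integral>y. g y * \<bar>f y - k y\<bar> \<partial>\<mu>)"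
proof -
  define G where "G x = (\<Prod>e\<in>\<pi>. g (\<omega> e x))" for x
  define b where "b = (\<integral>y. g y * k y \<partial>\<mu>)"
  define \<eta> where "\<eta> = (\<integral>y. g y * \<bar>f y - k y\<bar> \<partial>\<mu>)"
  define u where "u y = k y - b" for y
  have G_nonneg: "0 \<le> G x" for x unfolding G_def by (simp add: prod_nonneg g_nonneg)
  have ik: "integrable \<mu> (\<lambda>y. g y * k y)" by (rule integrable_g_bounded[OF k])
  have "integrable \<mu> (\<lambda>y. \<bar>g y * f y - g y * k y\<bar>)" using f(2) ik by auto
  moreover have "\<bar>g y * f y - g y * k y\<bar> = g y * \<bar>f y - k y\<bar>" for y
    using g_nonneg[of y] by (simp add: right_diff_distrib[symmetric] abs_mult)
  ultimately have id: "integrable \<mu> (\<lambda>y. g y * \<bar>f y - k y\<bar>)" by simp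
  have ab: "\<bar>a - b\<bar> \<le> \<eta>"
  proof -
    have "a - b = (\<integral>y. g y * f y - g y * k y \<partial>\<mu>)" using f ik by (simp add: b_def)
    also have "\<bar>\<dots>\<bar> \<le> (\<integral>y. \<bar>g y * f y - g y * k y\<bar> \<partial>\<mu>)" by (rule integral_abs_bound)
    also have "\<dots> = \<eta>" unfolding \<eta>_def
      using \<open>\<And>y. \<bar>g y * f y - g y * k y\<bar> = g y * \<bar>f y - k y\<bar>\<close> by simp
    finally show ?thesis .
  qed
  have bK: "\<bar>b\<bar> \<le> K"
  proof -
    have "\<bar>b\<bar> \<le> (\<integral>y. \<bar>g y * k y\<bar> \<partial>\<mu>)" unfolding b_def by (rule integral_abs_bound)
    also have "\<dots> \<le> (\<integral>y. g y * K \<partial>\<mu>)"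
      using ik g_int k(2) g_nonneg
      by (intro integral_mono integrable_abs) (auto simp: abs_mult intro: mult_left_mono)
    finally show ?thesis using g_mean by simp
  qed
  \<comment> \<open>Centring the truncation by its tilted mean \<open>b\<close> at most doubles the
    bound, hence \<open>(2 * K)\<^sup>2\<close> in the conclusion.\<close>
  have uK: "\<bar>u y\<bar> \<le> 2 * K" for y using k(2)[of y] bK unfolding u_def by linarith
  have um: "u \<in> borel_measurable borel" unfolding u_def using k(1) by simp
  have uc: "(\<integral>y. g y * u y \<partial>\<mu>) = 0"
    using ik g_int g_mean by (simp add: u_def right_diff_distrib b_def)
  note iS = integrable_tilted_square[OF \<pi> um uK uc] and eS = expectation_tilted_square_le[OF \<pi> um uK uc]
  have dm: "(\<lambda>y. \<bar>f y - k y\<bar>) \<in> borel_measurable borel" using f(1) k(1) by simp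
  have iD: "integrable M (\<lambda>x. G x * \<bar>f (\<omega> e x) - k (\<omega> e x)\<bar>)"
    and eD: "expectation (\<lambda>x. G x * \<bar>f (\<omega> e x) - k (\<omega> e x)\<bar>) = \<eta>" if "e \<in> \<pi>" for e
    using integrable_tilted[OF \<pi> that dm id] expectation_tilted[OF \<pi> that dm id]
    by (simp_all add: G_def \<eta>_def)
  have iG: "integrable M G" and eG: "expectation G = 1"
    unfolding G_def using expectation_prod[of \<pi> "\<lambda>_. g"] integrable_prod[of \<pi> "\<lambda>_. g"] S_sub[OF \<pi>]
    by (auto simp: g_meas g_int g_mean)
  \<comment> \<open>An integrable majorant of the weighted deviation. The density \<open>G\<close>
    has mean 1 and multiplies every term, so each expectation is one under the tilted law.\<close>
  define B where "B x = G x * (\<Sum>e\<in>\<pi>. u (\<omega> e x))\<^sup>2 / \<theta> + \<theta> * G x +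
    (\<Sum>e\<in>\<pi>. G x * \<bar>f (\<omega> e x) - k (\<omega> e x)\<bar>) + real m * \<eta> * G x" for x
  have iB: "integrable M B"
    unfolding B_def using iS iG iD by (auto simp: G_def[symmetric])
  have "expectation B \<le> real m * (2 * K)\<^sup>2 / \<theta> + \<theta> + real m * \<eta> + real m * \<eta>"
  proof -
    have "expectation B = expectation (\<lambda>x. G x * (\<Sum>e\<in>\<pi>. u (\<omega> e x))\<^sup>2) / \<theta> + \<theta> +
        real m * \<eta> + real m * \<eta>"
      unfolding B_def using iS iG iD eG eD S_card[OF \<pi>] by (simp add: G_def[symmetric])
    also have "\<dots> \<le> real m * (2 * K)\<^sup>2 / \<theta> + \<theta> + real m * \<eta> + real m * \<eta>"
      using eS \<theta> by (simp add: G_def[symmetric] divide_right_mono)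
    finally show ?thesis .
  qed
  hence eB: "expectation B \<le> real m * (2 * K)\<^sup>2 / \<theta> + \<theta> + 2 * real m * \<eta>" by linarith
  have bound: "G x * \<bar>\<Sum>e\<in>\<pi>. f (\<omega> e x) - a\<bar> \<le> B x" for x
  proof -
    define U where "U = (\<Sum>e\<in>\<pi>. u (\<omega> e x))"
    define R where "R = (\<Sum>e\<in>\<pi>. f (\<omega> e x) - k (\<omega> e x))"
    \<comment> \<open>Centred truncation, truncation error, and shift of the mean from
      \<open>b\<close> to \<open>a\<close>. The last two cost \<open>real m * \<eta>\<close> each,
      which explains the factor 2.\<close>
    have "(\<Sum>e\<in>\<pi>. f (\<omega> e x) - a) = U + R + real m * (b - a)"
      using S_card[OF \<pi>] by (simp add: U_def R_def u_def sum_subtractf algebra_simps)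
    hence "\<bar>\<Sum>e\<in>\<pi>. f (\<omega> e x) - a\<bar> \<le> \<bar>U\<bar> + \<bar>R\<bar> + real m * \<bar>b - a\<bar>"
      using abs_triangle_ineq[of "U + R" "real m * (b - a)"] abs_triangle_ineq[of U R]
      by (simp add: abs_mult)
    moreover have "\<bar>U\<bar> \<le> U\<^sup>2 / \<theta> + \<theta>"
    proof -
      have "0 \<le> (\<bar>U\<bar> - \<theta>)\<^sup>2" by simp
      hence "2 * \<bar>U\<bar> * \<theta> \<le> U\<^sup>2 + \<theta>\<^sup>2" by (simp add: power2_diff)
      moreover have "0 \<le> \<bar>U\<bar> * \<theta>" using \<theta> by simp
      ultimately have "\<bar>U\<bar> * \<theta> \<le> U\<^sup>2 + \<theta>\<^sup>2" by linarith
      hence "\<bar>U\<bar> \<le> (U\<^sup>2 + \<theta>\<^sup>2) / \<theta>" using \<theta> by (simp add: le_divide_eq)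
      also have "\<dots> = U\<^sup>2 / \<theta> + \<theta>" using \<theta> by (simp add: add_divide_distrib power2_eq_square)
      finally show ?thesis .
    qed
    moreover have "\<bar>R\<bar> \<le> (\<Sum>e\<in>\<pi>. \<bar>f (\<omega> e x) - k (\<omega> e x)\<bar>)" unfolding R_def by (rule sum_abs)
    moreover have "real m * \<bar>b - a\<bar> \<le> real m * \<eta>"
      using ab by (intro mult_left_mono) (auto simp: abs_minus_commute)
    ultimately have "\<bar>\<Sum>e\<in>\<pi>. f (\<omega> e x) - a\<bar> \<le>
        U\<^sup>2 / \<theta> + \<theta> + (\<Sum>e\<in>\<pi>. \<bar>f (\<omega> e x) - k (\<omega> e x)\<bar>) + real m * \<eta>" by linarith
    hence "G x * \<bar>\<Sum>e\<in>\<pi>. f (\<omega> e x) - a\<bar> \<le>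
        G x * (U\<^sup>2 / \<theta> + \<theta> + (\<Sum>e\<in>\<pi>. \<bar>f (\<omega> e x) - k (\<omega> e x)\<bar>) + real m * \<eta>)"
      using G_nonneg by (rule mult_left_mono)
    also have "\<dots> = B x"
      by (simp add: B_def U_def sum_distrib_left[symmetric] algebra_simps)
    finally show ?thesis .
  qed
  have [measurable]: "\<omega> e \<in> borel_measurable M" if "e \<in> \<pi>" for e
    using that S_sub[OF \<pi>] measurable_\<omega> by blast
  have "(\<lambda>x. G x * \<bar>\<Sum>e\<in>\<pi>. f (\<omega> e x) - a\<bar>) \<in> borel_measurable M"
    using borel_measurable_integrable[OF iG] f(1) by measurable
  hence i: "integrable M (\<lambda>x. G x * \<bar>\<Sum>e\<in>\<pi>. f (\<omega> e x) - a\<bar>)"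
    by (rule Bochner_Integration.integrable_bound[OF iB])
       (use bound order_trans[OF bound abs_ge_self] in \<open>auto simp: abs_mult G_nonneg\<close>)
  show "integrable M (\<lambda>x. (\<Prod>e\<in>\<pi>. g (\<omega> e x)) * \<bar>\<Sum>e\<in>\<pi>. f (\<omega> e x) - a\<bar>)"
    using i by (simp add: G_def)
  have "expectation (\<lambda>x. G x * \<bar>\<Sum>e\<in>\<pi>. f (\<omega> e x) - a\<bar>) \<le> expectation B"
    by (rule integral_mono[OF i iB bound])
  with eB show "expectation (\<lambda>x. (\<Prod>e\<in>\<pi>. g (\<omega> e x)) * \<bar>\<Sum>e\<in>\<pi>. f (\<omega> e x) - a\<bar>) \<le>
        real m * (2 * K)\<^sup>2 / \<theta> + \<theta> + 2 * real m * (\<integral>y. g y * \<bar>f y - k y\<bar> \<partial>\<mu>)"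
    by (simp add: G_def \<eta>_def)
qed

text \<open>\<open>Dev\<close> is \<open>Zbar\<close> times a Gibbs mean. Exchanging this mean with the expectation over the weights
  leaves, for each fixed \<open>\<pi>\<close>, weights on \<open>\<pi>\<close> that are i.i.d. with the tilted law \<open>g d\<mu>\<close>.\<close>

definition Dev :: "(ereal \<Rightarrow> real) \<Rightarrow> real \<Rightarrow> 'w \<Rightarrow> real" where
  "Dev f a x = (\<Sum>\<pi>\<in>S. (\<Prod>e\<in>\<pi>. g (\<omega> e x)) * \<bar>\<Sum>e\<in>\<pi>. f (\<omega> e x) - a\<bar>) / real (card S)"

text \<open>The bound for a single \<open>\<pi>\<close> is the same throughout \<open>S\<close>, so
  averaging preserves it.\<close>

lemma
  assumes f: "f \<in> borel_measurable borel" "integrable \<mu> (\<lambda>y. g y * f y)" "(\<integral>y. g y * f y \<partial>\<mu>) = a"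
    and k: "k \<in> borel_measurable borel" "\<And>y. \<bar>k y\<bar> \<le> K"
    and \<theta>: "0 < \<theta>"
  shows integrable_Dev: "integrable M (Dev f a)"
    and expectation_Dev_le: "expectation (Dev f a) \<le>
        real m * (2 * K)\<^sup>2 / \<theta> + \<theta> + 2 * real m * (\<integral>y. g y * \<bar>f y - k y\<bar> \<partial>\<mu>)"
proof -
  note i = integrable_tilted_deviation[OF _ assms] and e = expectation_tilted_deviation_le[OF _ assms]
  show "integrable M (Dev f a)" unfolding Dev_def using i by auto
  have "expectation (Dev f a) = (\<Sum>\<pi>\<in>S. expectation (\<lambda>x. (\<Prod>e\<in>\<pi>. g (\<omega> e x)) * \<bar>\<Sum>e\<in>\<pi>. f (\<omega> e x) - a\<bar>)) / real (card S)"
    unfolding Dev_def using i by simp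
  also have "\<dots> \<le> (\<Sum>\<pi>\<in>S. real m * (2 * K)\<^sup>2 / \<theta> + \<theta> + 2 * real m * (\<integral>y. g y * \<bar>f y - k y\<bar> \<partial>\<mu>)) / real (card S)"
    using e by (intro divide_right_mono sum_mono) auto
  also have "\<dots> = real m * (2 * K)\<^sup>2 / \<theta> + \<theta> + 2 * real m * (\<integral>y. g y * \<bar>f y - k y\<bar> \<partial>\<mu>)"
    using card_S_pos by simp
  finally show "expectation (Dev f a) \<le>
        real m * (2 * K)\<^sup>2 / \<theta> + \<theta> + 2 * real m * (\<integral>y. g y * \<bar>f y - k y\<bar> \<partial>\<mu>)" .
qed

lemma Dev_nonneg: "0 \<le> Dev f a x"
  unfolding Dev_def by (intro divide_nonneg_nonneg sum_nonneg mult_nonneg_nonneg prod_nonneg) (auto simp: g_nonneg)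

end

section \<open>Pointwise control of the free energy and the mean weight by \<open>Zbar\<close> and
  \<open>Dev\<close>\<close>

lemma (in iid_family) AE_not_minus_infinity:
  assumes "measure \<mu> {- \<infinity>} = 0"
  shows "AE x in M. \<forall>e\<in>E. \<omega> e x \<noteq> - \<infinity>"
proof (subst AE_finite_all[OF finite_E], intro ballI)
  fix e assume e: "e \<in> E"
  interpret law: prob_space \<mu> by (rule prob_\<mu>)
  have "{- \<infinity>} \<in> null_sets \<mu>"
    using assms sets_\<mu> by (simp add: null_sets_def law.emeasure_eq_measure)
  hence "AE y in \<mu>. y \<notin> {- \<infinity>}" by (rule AE_not_in)
  hence "AE y in distr M borel (\<omega> e). y \<noteq> - \<infinity>" unfolding law[OF e] by simp
  thus "AE x in M. \<omega> e x \<noteq> - \<infinity>" by (rule AE_distrD[OF measurable_\<omega>[OF e]])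
qed

context weighted_ensemble
begin

lemma prob_Zbar_ge: "0 < t \<Longrightarrow> prob {x \<in> space M. Zbar x \<ge> t} \<le> 1 / t"
  using integral_Markov_inequality_measure[OF integrable_Zbar sets.empty_sets, of t]
  by (simp add: expectation_Zbar Zbar_nonneg)

text \<open>Taking logarithms in \<open>Z = L ^ m * Zbar\<close> reduces the first limit to showing
  that \<open>ln Zbar\<close> is of smaller order than \<open>m\<close>.\<close>

lemma scaled_log_partition_eq:
  assumes g: "g = (\<lambda>y. boltzmann \<beta> y / L)" and L: "0 < L" and m: "0 < m"
    and w: "\<forall>e\<in>E. \<omega> e x \<noteq> - \<infinity>" and Z: "0 < Zbar x"
  shows "ereal (1 / real m) * log_partition S \<beta> (\<lambda>e. \<omega> e x) = ereal (ln L + ln (Zbar x) / real m)"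
proof -
  have "partition_function S \<beta> (\<lambda>e. \<omega> e x) = L ^ m * Zbar x"
    unfolding Zbar_def unfolding g using finite_S finite_mem_S S_card S_sub w L
    by (intro partition_function_eq) (auto dest: S_sub[THEN subsetD])
  moreover have "ln (L ^ m * Zbar x) = real m * ln L + ln (Zbar x)"
    using L Z by (simp add: ln_mult ln_realpow)
  ultimately show ?thesis
    using L Z m by (simp add: log_partition_def add_divide_distrib)
qed

text \<open>The Gibbs weights are the edge products divided by \<open>Zbar * card S\<close>.
  Centring each total weight at \<open>m * a\<close> and moving the absolute value inside the Gibbs
  mean produces \<open>Dev\<close>.\<close>

lemma scaled_gibbs_mean_deviation_le:
  assumes g: "g = (\<lambda>y. boltzmann \<beta> y / L)" and L: "0 < L" and m: "0 < m"
    and w: "\<forall>e\<in>E. \<omega> e x \<noteq> - \<infinity>" and Z: "0 < Zbar x"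
  shows "\<bar>ereal (1 / real m) * gibbs_mean S \<beta> (\<lambda>e. \<omega> e x) (total_weight (\<lambda>e. \<omega> e x)) - ereal a\<bar>
    \<le> ereal (Dev real_of_ereal a x / (real m * Zbar x))"
proof -
  define G where "G \<pi> = (\<Prod>e\<in>\<pi>. g (\<omega> e x))" for \<pi>
  define W where "W \<pi> = (\<Sum>e\<in>\<pi>. real_of_ereal (\<omega> e x))" for \<pi>
  let ?c = "real m * (Zbar x * real (card S))"
  have mean: "gibbs_mean S \<beta> (\<lambda>e. \<omega> e x) (total_weight (\<lambda>e. \<omega> e x)) =
      ereal ((\<Sum>\<pi>\<in>S. G \<pi> * W \<pi>) / (Zbar x * real (card S)))"
  proof -
    have Zb: "(\<Sum>\<pi>\<in>S. \<Prod>e\<in>\<pi>. boltzmann \<beta> (\<omega> e x) / L) / real (card S) = Zbar x"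
      unfolding Zbar_def unfolding g ..
    have w': "\<omega> e x \<noteq> - \<infinity>" if "\<pi> \<in> S" "e \<in> \<pi>" for \<pi> e using w S_sub that by blast
    have "G \<pi> = (\<Prod>e\<in>\<pi>. boltzmann \<beta> (\<omega> e x) / L)" for \<pi> unfolding G_def unfolding g ..
    thus ?thesis
      using gibbs_mean_eq[OF finite_S _ w' L Zb Z, of m] finite_mem_S S_card by (simp add: W_def)
  qed
  have G_nonneg: "0 \<le> G \<pi>" for \<pi> unfolding G_def by (simp add: prod_nonneg g_nonneg)
  have c: "0 < ?c" using m Z card_S_pos by simp
  have "(\<Sum>\<pi>\<in>S. G \<pi>) = Zbar x * real (card S)"
    using card_S_pos by (simp add: Zbar_def G_def)
  \<comment> \<open>The constant is spread over \<open>S\<close> by means of the normalisation, so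
    it can be subtracted edge by edge.\<close>
  hence "(\<Sum>\<pi>\<in>S. G \<pi> * W \<pi>) - a * ?c = (\<Sum>\<pi>\<in>S. G \<pi> * W \<pi>) - (\<Sum>\<pi>\<in>S. G \<pi> * (real m * a))"
    unfolding sum_distrib_right[symmetric] by simp
  also have "\<dots> = (\<Sum>\<pi>\<in>S. G \<pi> * (\<Sum>e\<in>\<pi>. real_of_ereal (\<omega> e x) - a))"
    using S_card by (simp add: W_def sum_subtractf right_diff_distrib)
  finally have "\<bar>(\<Sum>\<pi>\<in>S. G \<pi> * W \<pi>) - a * ?c\<bar> \<le>
      (\<Sum>\<pi>\<in>S. \<bar>G \<pi> * (\<Sum>e\<in>\<pi>. real_of_ereal (\<omega> e x) - a)\<bar>)"
    by (simp only: sum_abs)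
  also have "\<dots> = Dev real_of_ereal a x * real (card S)"
    using card_S_pos G_nonneg by (simp add: Dev_def abs_mult G_def)
  finally have "\<bar>(\<Sum>\<pi>\<in>S. G \<pi> * W \<pi>) - a * ?c\<bar> / ?c \<le> Dev real_of_ereal a x * real (card S) / ?c"
    using c by (intro divide_right_mono) auto
  also have "\<dots> = Dev real_of_ereal a x / (real m * Zbar x)" using card_S_pos by simp
  also have "\<bar>(\<Sum>\<pi>\<in>S. G \<pi> * W \<pi>) - a * ?c\<bar> / ?c = \<bar>(\<Sum>\<pi>\<in>S. G \<pi> * W \<pi>) / ?c - a\<bar>"
  proof -
    have c0: "?c \<noteq> 0" using c by linarith
    have "(\<Sum>\<pi>\<in>S. G \<pi> * W \<pi>) / ?c - a = ((\<Sum>\<pi>\<in>S. G \<pi> * W \<pi>) - a * ?c) / ?c"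
      by (simp only: diff_divide_distrib nonzero_mult_div_cancel_right[OF c0])
    thus ?thesis using c by (simp only: abs_divide abs_of_pos)
  qed
  finally show ?thesis unfolding mean by simp
qed

end

section \<open>Limits along the sequence of graphs\<close>

text \<open>From \<open>N \<ge> k * v\<^sup>2\<close> and \<open>v \<ge> n\<close> the edge count
  diverges. Then \<open>m\<^sup>2 = (m\<^sup>2 / N) * N\<close> diverges,
  \<open>p\<^sup>2 = (m\<^sup>2 / N) / N\<close> vanishes, and \<open>v ^ 3 / N\<^sup>2\<close> is
  at most \<open>1 / (k\<^sup>2 * v)\<close>.\<close>

lemma density_asymptotics:
  fixes N m v :: "nat \<Rightarrow> nat"
  assumes N: "(\<lambda>n. real (N n)) \<in> \<Theta>(\<lambda>n. (real (v n))\<^sup>2)"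
    and v: "\<And>n. n \<ge> 1 \<Longrightarrow> n \<le> v n"
    and q: "(\<lambda>n. (real (m n))\<^sup>2 / real (N n)) \<longlonglongrightarrow> a" and a: "0 < a"
  shows "filterlim (\<lambda>n. real (N n)) at_top sequentially"
    and "filterlim (\<lambda>n. real (m n)) at_top sequentially"
    and "(\<lambda>n. real (m n) / real (N n)) \<longlonglongrightarrow> 0"
    and "(\<lambda>n. real (v n) ^ 3 / (real (N n))\<^sup>2) \<longlonglongrightarrow> 0"
proof -
  obtain k where k: "0 < k"
    and ev: "\<forall>\<^sub>F n in sequentially. norm (real (N n)) \<ge> k * norm ((real (v n))\<^sup>2)"
    using landau_omega.bigE[OF bigthetaD2[OF N]] by blast
  have ev: "\<forall>\<^sub>F n in sequentially. 1 \<le> n \<and> real n \<le> real (v n) \<and> k * (real (v n))\<^sup>2 \<le> real (N n)"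
    using ev eventually_ge_at_top[of 1] by eventually_elim (use v in auto)
  show N_top: "filterlim (\<lambda>n. real (N n)) at_top sequentially"
  proof (rule filterlim_at_top_mono)
    show "filterlim (\<lambda>n. k * real n) at_top sequentially"
      by (rule filterlim_tendsto_pos_mult_at_top[OF tendsto_const k filterlim_real_sequentially])
    show "\<forall>\<^sub>F n in sequentially. k * real n \<le> real (N n)"
      using ev
    proof eventually_elim
      case (elim n)
      hence "real (v n) * 1 \<le> real (v n) * real (v n)" by (intro mult_left_mono) linarith+
      hence "real n \<le> (real (v n))\<^sup>2" using elim unfolding power2_eq_square by linarith
      thus ?case using elim k mult_left_mono[of "real n" "(real (v n))\<^sup>2" k] by linarith
    qed
  qed
  have N_pos: "\<forall>\<^sub>F n in sequentially. 0 < real (N n)"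
    using N_top unfolding filterlim_at_top_dense by blast
  have "filterlim (\<lambda>n. (real (m n))\<^sup>2 / real (N n) * real (N n)) at_top sequentially"
    by (rule filterlim_tendsto_pos_mult_at_top[OF q a N_top])
  hence "filterlim (\<lambda>n. sqrt ((real (m n))\<^sup>2 / real (N n) * real (N n))) at_top sequentially"
    by (rule filterlim_compose[OF sqrt_at_top])
  moreover have "\<forall>\<^sub>F n in sequentially. sqrt ((real (m n))\<^sup>2 / real (N n) * real (N n)) = real (m n)"
    using N_pos by eventually_elim simp
  ultimately show "filterlim (\<lambda>n. real (m n)) at_top sequentially"
    by (rule filterlim_cong[OF refl refl, THEN iffD1, rotated])
  have "(\<lambda>n. (real (m n))\<^sup>2 / real (N n) / real (N n)) \<longlonglongrightarrow> 0"
    by (rule real_tendsto_divide_at_top[OF q N_top])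
  hence "(\<lambda>n. sqrt ((real (m n))\<^sup>2 / real (N n) / real (N n))) \<longlonglongrightarrow> sqrt 0"
    by (rule tendsto_real_sqrt)
  moreover have "sqrt ((real (m n))\<^sup>2 / real (N n) / real (N n)) = real (m n) / real (N n)" for n
    by (simp add: real_sqrt_divide real_sqrt_mult[symmetric] divide_divide_eq_left)
  ultimately show "(\<lambda>n. real (m n) / real (N n)) \<longlonglongrightarrow> 0" by simp
  have "(\<lambda>n. 1 / k\<^sup>2 * (1 / real n)) \<longlonglongrightarrow> 1 / k\<^sup>2 * 0"
    by (intro tendsto_intros lim_1_over_n)
  hence "(\<lambda>n. 1 / k\<^sup>2 * (1 / real n)) \<longlonglongrightarrow> 0" by simp
  show "(\<lambda>n. real (v n) ^ 3 / (real (N n))\<^sup>2) \<longlonglongrightarrow> 0"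
  proof (rule tendsto_sandwich[where f = "\<lambda>_. 0" and h = "\<lambda>n. 1 / k\<^sup>2 * (1 / real n)"])
    show "(\<lambda>n. 1 / k\<^sup>2 * (1 / real n)) \<longlonglongrightarrow> 0" by fact
    show "(\<lambda>n. 0) \<longlonglongrightarrow> (0::real)" by (rule tendsto_const)
    show "\<forall>\<^sub>F n in sequentially. real (v n) ^ 3 / (real (N n))\<^sup>2 \<le> 1 / k\<^sup>2 * (1 / real n)"
      using ev
    proof eventually_elim
      case (elim n)
      hence v0: "0 < real (v n)" by linarith
      have "0 < k * (real (v n))\<^sup>2" using k v0 by simp
      hence "0 < real (N n)" using elim by linarith
      hence "real (v n) ^ 3 / (real (N n))\<^sup>2 \<le> real (v n) ^ 3 / (k * (real (v n))\<^sup>2)\<^sup>2"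
        using elim v0 k by (intro divide_left_mono power_mono mult_pos_pos zero_less_power) auto
      also have "\<dots> = 1 / k\<^sup>2 * (1 / real (v n))"
        using v0 k by (simp add: field_simps power2_eq_square power3_eq_cube)
      also have "\<dots> \<le> 1 / k\<^sup>2 * (1 / real n)"
        using elim by (intro mult_left_mono divide_left_mono) auto
      finally show ?case .
    qed
  qed auto
qed

text \<open>The order of choices matters: first \<open>\<delta>\<close> is fixed so that the
  contribution of \<open>1 / X\<close> is at most \<open>\<eta> / 2\<close>; then \<open>n\<close>
  grows until the squared distance between \<open>Zbar\<close> and \<open>X\<close> has mean at most
  \<open>\<delta>\<^sup>2 * (\<eta> / 2)\<close>.\<close>

lemma Zbar_lower_tail:
  fixes M :: "nat \<Rightarrow> 'w measure" and V :: "nat \<Rightarrow> 'v set" and E :: "nat \<Rightarrow> 'v set set"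
    and S :: "nat \<Rightarrow> 'v set set set" and m :: "nat \<Rightarrow> nat" and a \<rho> s :: real
  assumes ens: "\<And>n. n \<ge> 1 \<Longrightarrow> weighted_ensemble (M n) (E n) (\<omega> n) \<mu> (S n) (m n) g s"
    and G: "\<And>n. n \<ge> 1 \<Longrightarrow> simple_graph (V n) (E n)"
    and N: "filterlim (\<lambda>n. real (card (E n))) at_top sequentially"
    and m: "filterlim (\<lambda>n. real (m n)) at_top sequentially"
    and q: "(\<lambda>n. (real (m n))\<^sup>2 / real (card (E n))) \<longlonglongrightarrow> a"
    and p: "(\<lambda>n. real (m n) / real (card (E n))) \<longlonglongrightarrow> 0"
    and v: "(\<lambda>n. real (card (V n)) ^ 3 / (real (card (E n)))\<^sup>2) \<longlonglongrightarrow> 0"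
    and \<rho>: "1 \<le> \<rho>"
    and edge: "\<And>n e. n \<ge> 1 \<Longrightarrow> e \<in> E n \<Longrightarrow> P0_incl (S n) {e} = real (m n) / real (card (E n))"
    and matching: "\<And>n \<Gamma>. n \<ge> 1 \<Longrightarrow> partial_matching (E n) \<Gamma> \<Longrightarrow>
      \<bar>P0_incl (S n) \<Gamma> / (\<Prod>e\<in>\<Gamma>. P0_incl (S n) {e}) - 1\<bar> \<le> \<rho> ^ card \<Gamma> / sqrt (real (m n))"
    and nonmatching: "\<And>n \<Gamma>. n \<ge> 1 \<Longrightarrow> \<Gamma> \<in> down_closure (S n) \<Longrightarrow> \<not> partial_matching (E n) \<Gamma> \<Longrightarrow>
      P0_incl (S n) \<Gamma> \<le> \<rho> ^ card \<Gamma> * (\<Prod>e\<in>\<Gamma>. P0_incl (S n) {e})"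
    and \<eta>: "0 < \<eta>"
  shows "\<exists>\<delta>>0. \<forall>\<^sub>F n in sequentially.
    measure (M n) {x \<in> space (M n). weighted_ensemble.Zbar (\<omega> n) (S n) g x < \<delta>} \<le> \<eta>"
proof -
  have s: "0 \<le> s" using weighted_ensemble.s_nonneg[OF ens[of 1]] by simp
  \<comment> \<open>\<open>C\<close> eventually bounds
    \<open>(1 + 2 * p\<^sup>2 * s) ^ card E\<close>, since \<open>m\<^sup>2 / card E\<close> is
    eventually below \<open>a + 1\<close>. With \<open>\<delta> = \<eta> / (4 * C)\<close> the term
    \<open>2 * \<delta> * C\<close> equals \<open>\<eta> / 2\<close>.\<close>
  define C where "C = exp (2 * s * (a + 1))"
  define \<delta> where "\<delta> = \<eta> / (4 * C)"
  have \<delta>: "0 < \<delta>" using \<eta> by (simp add: \<delta>_def C_def)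
  have "\<forall>\<^sub>F n in sequentially. (real (m n))\<^sup>2 / real (card (E n)) < a + 1"
    by (rule order_tendstoD(2)[OF q]) simp
  moreover have "\<forall>\<^sub>F n in sequentially. real (m n) / real (card (E n)) < 1/2"
    by (rule order_tendstoD(2)[OF p]) simp
  moreover have "\<forall>\<^sub>F n in sequentially. 0 < real (card (E n))"
    using N unfolding filterlim_at_top_dense by blast
  moreover have "\<forall>\<^sub>F n in sequentially. 0 < real (m n)"
    using m unfolding filterlim_at_top_dense by blast
  moreover have "0 < \<delta>\<^sup>2 * (\<eta> / 2)" using \<delta> \<eta> by simp
  note overlap_error_tendsto_0[OF s N m q p v this, of \<rho>]
  ultimately have "\<forall>\<^sub>F n in sequentially.
      measure (M n) {x \<in> space (M n). weighted_ensemble.Zbar (\<omega> n) (S n) g x < \<delta>} \<le> \<eta>"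
    using eventually_ge_at_top[of 1]
  proof eventually_elim
    case (elim n)
    interpret weighted_ensemble "M n" "E n" "\<omega> n" \<mu> "S n" "m n" g s by (rule ens[OF elim(6)])
    let ?p = "real (m n) / real (card (E n))"
    let ?Q = "(\<Sum>\<pi>\<in>S n. \<Sum>\<pi>'\<in>S n. (1 + s) ^ card (\<pi> \<inter> \<pi>')) / (real (card (S n)))\<^sup>2"
    have p: "0 < ?p" "0 \<le> ?p" "?p \<le> 1/2" using elim by auto
    have "prob {x \<in> space (M n). Zbar x < \<delta>} \<le> 2 * \<delta> * (1 + 2 * ?p\<^sup>2 * s) ^ card (E n) +
      (?Q - 2 * (1 + ?p * s) ^ m n + (1 + ?p\<^sup>2 * s) ^ card (E n)) / \<delta>\<^sup>2"
      by (rule prob_Zbar_less[OF p(2,3) \<delta>])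
    also have "(1 + 2 * ?p\<^sup>2 * s) ^ card (E n) \<le> C"
    proof -
      have "(1 + 2 * ?p\<^sup>2 * s) ^ card (E n) \<le> exp (2 * ?p\<^sup>2 * s) ^ card (E n)"
        using s by (intro power_mono exp_ge_add_one_self) auto
      also have "\<dots> = exp (2 * s * ((real (m n))\<^sup>2 / real (card (E n))))"
        using elim by (simp add: exp_of_nat_mult[symmetric] power2_eq_square field_simps)
      also have "2 * s * ((real (m n))\<^sup>2 / real (card (E n))) \<le> 2 * s * (a + 1)"
        using elim s by (intro mult_left_mono) auto
      hence "exp (2 * s * ((real (m n))\<^sup>2 / real (card (E n)))) \<le> C" by (simp add: C_def)
      finally show ?thesis .
    qed
    also have "?Q - 2 * (1 + ?p * s) ^ m n + (1 + ?p\<^sup>2 * s) ^ card (E n) \<le> \<delta>\<^sup>2 * (\<eta> / 2)"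
    proof -
      have "?Q \<le> (1 + ?p\<^sup>2 * s) ^ card (E n) + (3 / sqrt (real (m n)) +
          real (card (V n)) ^ 3 * (\<rho>\<^sup>2 * ?p\<^sup>2 * s)\<^sup>2) * (1 + \<rho>\<^sup>2 * ?p\<^sup>2 * s) ^ card (E n)"
        using S_ne S_sub s p(1) \<rho> elim(4,6) edge matching nonmatching
        by (intro overlap_moment_le[OF G]) auto
      with elim(5) show ?thesis by linarith
    qed
    finally have "prob {x \<in> space (M n). Zbar x < \<delta>} \<le> 2 * \<delta> * C + \<delta>\<^sup>2 * (\<eta> / 2) / \<delta>\<^sup>2"
      using \<delta> by (simp add: mult_left_mono divide_right_mono)
    also have "\<dots> = \<eta>" using \<delta> by (simp add: \<delta>_def C_def)
    finally show ?case .
  qed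
  thus ?thesis using \<delta> by blast
qed

section \<open>The two limits in probability\<close>

theorem corollary2p3:
  fixes V :: "nat \<Rightarrow> 'v set" and E :: "nat \<Rightarrow> 'v set set"
    and S :: "nat \<Rightarrow> 'v set set set"
    and c :: nat and m :: "nat \<Rightarrow> nat" and \<gamma> :: real
    and M :: "nat \<Rightarrow> 'w measure" and \<omega> :: "nat \<Rightarrow> 'v set \<Rightarrow> 'w \<Rightarrow> ereal"
    and \<mu> :: "ereal measure" and \<beta> :: real
  assumes graph: "\<And>n. n \<ge> 1 \<Longrightarrow> simple_graph (V n) (E n)"
    and edge_trans: "\<And>n. n \<ge> 1 \<Longrightarrow> edge_transitive (V n) (E n)"
    and card_V: "\<And>n. n \<ge> 1 \<Longrightarrow> card (V n) = c * n"
    and c_pos: "c \<ge> 1"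
    and card_E: "(\<lambda>n. real (card (E n))) \<in> \<Theta>(\<lambda>n. (real (card (V n)))\<^sup>2)"
    and law_prob: "prob_space \<mu>" and law_sets: "sets \<mu> = sets borel"
    and law_not_minf: "measure \<mu> {- \<infinity>} = 0"
    and law_not_as_inf: "measure \<mu> {\<infinity>} < 1"
    and law_exp_moments: "\<And>b. b \<ge> 0 \<Longrightarrow> integrable \<mu> (boltzmann b)"
    and M_prob: "\<And>n. n \<ge> 1 \<Longrightarrow> prob_space (M n)"
    and weights_indep: "\<And>n. n \<ge> 1 \<Longrightarrow> prob_space.indep_vars (M n) (\<lambda>_. borel) (\<omega> n) (E n)"
    and weights_law: "\<And>n e. n \<ge> 1 \<Longrightarrow> e \<in> E n \<Longrightarrow> distr (M n) borel (\<omega> n e) = \<mu>"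
    and S_nonempty: "\<And>n. n \<ge> 1 \<Longrightarrow> S n \<noteq> {}"
    and S_subgraphs: "\<And>n \<pi>. n \<ge> 1 \<Longrightarrow> \<pi> \<in> S n \<Longrightarrow> \<pi> \<subseteq> E n"
    and S_card: "\<And>n \<pi>. n \<ge> 1 \<Longrightarrow> \<pi> \<in> S n \<Longrightarrow> card \<pi> = m n"
    and gamma_pos: "\<gamma> > 0"
    and gamma_lim: "(\<lambda>n. (real (m n))\<^sup>2 / (2 * real (card (E n)))) \<longlonglongrightarrow> \<gamma>"
    and matching_extends:
      "\<And>n \<Gamma>. n \<ge> 1 \<Longrightarrow> partial_matching (E n) \<Gamma> \<Longrightarrow> \<exists>\<pi>\<in>S n. \<Gamma> \<subseteq> \<pi>"
    and matching_prob:
      "\<exists>\<rho>>0. \<forall>n\<ge>1. \<forall>k \<Gamma>. partial_matching (E n) \<Gamma> \<and> card \<Gamma> = k \<longrightarrow>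
         \<bar>P0_incl (S n) \<Gamma> / (\<Prod>e\<in>\<Gamma>. P0_incl (S n) {e}) - 1\<bar> \<le> \<rho> ^ k / sqrt (real (m n))"
    and non_matching_prob:
      "\<exists>\<rho>>0. \<forall>n\<ge>1. \<forall>k \<Gamma>. \<Gamma> \<in> down_closure (S n) \<and> \<not> partial_matching (E n) \<Gamma> \<and> card \<Gamma> = k \<longrightarrow>
         P0_incl (S n) \<Gamma> \<le> \<rho> ^ k * (\<Prod>e\<in>\<Gamma>. P0_incl (S n) {e})"
    and edge_prob:
      "\<And>n e. n \<ge> 1 \<Longrightarrow> e \<in> E n \<Longrightarrow> P0_incl (S n) {e} = real (m n) / real (card (E n))"
    and beta_nonneg: "\<beta> \<ge> 0"
  shows "tendsto_in_prob M
           (\<lambda>n x. ereal (1 / real (m n)) * log_partition (S n) \<beta> (\<lambda>e. \<omega> n e x))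
           (log_laplace \<mu> \<beta>) \<and>
         (\<forall>D. (log_laplace \<mu> has_real_derivative D) (at \<beta> within {0..}) \<longrightarrow>
           tendsto_in_prob M
             (\<lambda>n x. ereal (1 / real (m n)) *
                gibbs_mean (S n) \<beta> (\<lambda>e. \<omega> n e x) (total_weight (\<lambda>e. \<omega> n e x)))
             (- D))"
proof -
  interpret law: prob_space \<mu> by (rule law_prob)
  define L where "L = (\<integral>y. boltzmann \<beta> y \<partial>\<mu>)"
  define g where "g = (\<lambda>y. boltzmann \<beta> y / L)"
  define s where "s = (\<integral>y. (g y)\<^sup>2 \<partial>\<mu>) - 1"
  note int_\<beta> = law_exp_moments[OF beta_nonneg]
  have L: "0 < L"
    unfolding L_def by (rule expectation_boltzmann_pos[OF law_prob law_sets law_not_as_inf int_\<beta>])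
  have g_meas: "g \<in> borel_measurable borel" unfolding g_def by measurable
  have g_nonneg: "0 \<le> g y" for y using L by (simp add: g_def boltzmann_nonneg)
  \<comment> \<open>The second moment of \<open>g\<close> is an exponential moment at
    \<open>2 * \<beta>\<close>, hence finite.\<close>
  have "(boltzmann \<beta> y)\<^sup>2 = boltzmann (2 * \<beta>) y" for y
    by (simp add: boltzmann_def exp_double[symmetric])
  hence g2: "(g y)\<^sup>2 = boltzmann (2 * \<beta>) y / L\<^sup>2" for y by (simp add: g_def power_divide)
  have g2_int: "integrable \<mu> (\<lambda>y. (g y)\<^sup>2)"
    unfolding g2 using law_exp_moments[of "2 * \<beta>"] beta_nonneg by simp
  have g_int: "integrable \<mu> g" unfolding g_def using int_\<beta> by simp
  have g_mean: "(\<integral>y. g y \<partial>\<mu>) = 1" unfolding g_def using L by (simp add: L_def)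
  have E_fin: "finite (E n)" if "n \<ge> 1" for n
    using graph[OF that] finite_subset[of "E n" "Pow (V n)"] by (auto simp: simple_graph_def)
  have ens: "weighted_ensemble (M n) (E n) (\<omega> n) \<mu> (S n) (m n) g s" if n: "n \<ge> 1" for n
  proof -
    interpret prob_space "M n" by (rule M_prob[OF n])
    show ?thesis
      by unfold_locales
        (use n E_fin weights_indep weights_law law_prob law_sets S_nonempty S_subgraphs S_card g_meas
          g_nonneg g_int g_mean g2_int in \<open>auto simp: s_def\<close>)
  qed
  have v: "n \<le> card (V n)" if "n \<ge> 1" for n using card_V[OF that] c_pos by simp
  have "(\<lambda>n. 2 * ((real (m n))\<^sup>2 / (2 * real (card (E n))))) \<longlonglongrightarrow> 2 * \<gamma>"
    by (intro tendsto_intros gamma_lim)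
  hence q: "(\<lambda>n. (real (m n))\<^sup>2 / real (card (E n))) \<longlonglongrightarrow> 2 * \<gamma>" by simp
  have \<gamma>2: "0 < 2 * \<gamma>" using gamma_pos by simp
  note asym = density_asymptotics[OF card_E v q \<gamma>2]
  note m_top = asym(2)
  obtain \<rho>1 where \<rho>1: "\<rho>1 > 0" and mat: "\<And>n \<Gamma>. n \<ge> 1 \<Longrightarrow> partial_matching (E n) \<Gamma> \<Longrightarrow>
      \<bar>P0_incl (S n) \<Gamma> / (\<Prod>e\<in>\<Gamma>. P0_incl (S n) {e}) - 1\<bar> \<le> \<rho>1 ^ card \<Gamma> / sqrt (real (m n))"
    using matching_prob by blast
  obtain \<rho>2 where \<rho>2: "\<rho>2 > 0" and nonmat: "\<And>n \<Gamma>. n \<ge> 1 \<Longrightarrow> \<Gamma> \<in> down_closure (S n) \<Longrightarrow>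
      \<not> partial_matching (E n) \<Gamma> \<Longrightarrow> P0_incl (S n) \<Gamma> \<le> \<rho>2 ^ card \<Gamma> * (\<Prod>e\<in>\<Gamma>. P0_incl (S n) {e})"
    using non_matching_prob by blast
  \<comment> \<open>One constant serves both probability assumptions; it is raised to at least 1, as
    \<open>overlap_moment_le\<close> requires.\<close>
  define \<rho> where "\<rho> = max 1 (max \<rho>1 \<rho>2)"
  have \<rho>: "1 \<le> \<rho>" by (simp add: \<rho>_def)
  have \<rho>1_le: "\<rho>1 ^ k \<le> \<rho> ^ k" and \<rho>2_le: "\<rho>2 ^ k \<le> \<rho> ^ k" for k
    using \<rho>1 \<rho>2 by (auto simp: \<rho>_def intro!: power_mono)
  have mat': "\<bar>P0_incl (S n) \<Gamma> / (\<Prod>e\<in>\<Gamma>. P0_incl (S n) {e}) - 1\<bar> \<le> \<rho> ^ card \<Gamma> / sqrt (real (m n))"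
    if "n \<ge> 1" "partial_matching (E n) \<Gamma>" for n \<Gamma>
    using mat[OF that] divide_right_mono[OF \<rho>1_le, of "sqrt (real (m n))"] by (rule order_trans) simp
  have nonmat': "P0_incl (S n) \<Gamma> \<le> \<rho> ^ card \<Gamma> * (\<Prod>e\<in>\<Gamma>. P0_incl (S n) {e})"
    if "n \<ge> 1" "\<Gamma> \<in> down_closure (S n)" "\<not> partial_matching (E n) \<Gamma>" for n \<Gamma>
    using nonmat[OF that] mult_right_mono[OF \<rho>2_le] by (rule order_trans) (auto simp: P0_incl_def intro: prod_nonneg)
  have tail: "\<exists>\<delta>>0. \<forall>\<^sub>F n in sequentially.
      measure (M n) {x \<in> space (M n). weighted_ensemble.Zbar (\<omega> n) (S n) g x < \<delta>} \<le> \<eta>"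
    if "0 < \<eta>" for \<eta>
    by (rule Zbar_lower_tail[OF ens graph asym(1,2) q asym(3,4) \<rho> edge_prob mat' nonmat' that])
  have lim0: "u \<longlonglongrightarrow> 0"
    if "\<And>n. 0 \<le> u n" "\<And>\<eta>. 0 < \<eta> \<Longrightarrow> \<forall>\<^sub>F n in sequentially. u n \<le> \<eta>" for u :: "nat \<Rightarrow> real"
  proof (rule tendstoI)
    fix \<eta> :: real assume "0 < \<eta>"
    hence "\<forall>\<^sub>F n in sequentially. u n \<le> \<eta> / 2" by (intro that(2)) simp
    thus "\<forall>\<^sub>F n in sequentially. dist (u n) 0 < \<eta>"
      by eventually_elim (use that(1) \<open>0 < \<eta>\<close> in \<open>auto simp: dist_real_def\<close>)
  qed
  show ?thesis
  proof (intro conjI allI impI)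
    show "tendsto_in_prob M (\<lambda>n x. ereal (1 / real (m n)) * log_partition (S n) \<beta> (\<lambda>e. \<omega> n e x))
        (log_laplace \<mu> \<beta>)"
      unfolding tendsto_in_prob_def
    proof (intro allI impI lim0)
      fix \<epsilon> \<eta> :: real assume \<epsilon>: "0 < \<epsilon>" and \<eta>: "0 < \<eta>"
      obtain \<delta> where \<delta>: "0 < \<delta>" and tl: "\<forall>\<^sub>F n in sequentially.
          measure (M n) {x \<in> space (M n). weighted_ensemble.Zbar (\<omega> n) (S n) g x < \<delta>} \<le> \<eta> / 2"
        using tail[of "\<eta> / 2"] \<eta> by auto
      have "filterlim (\<lambda>n. \<epsilon> * real (m n)) at_top sequentially"
        by (rule filterlim_tendsto_pos_mult_at_top[OF tendsto_const \<epsilon> m_top])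
      hence "filterlim (\<lambda>n. exp (\<epsilon> * real (m n))) at_top sequentially"
        by (rule filterlim_compose[OF exp_at_top])
      \<comment> \<open>The first bound makes \<open>exp (- \<epsilon> * m) \<le> \<delta>\<close>,
        so \<open>\<delta> \<le> Zbar < exp (\<epsilon> * m)\<close> forces
        \<open>\<bar>ln Zbar\<bar> \<le> \<epsilon> * m\<close>; the second makes the upper tail of
        \<open>Zbar\<close> at most \<open>\<eta> / 2\<close>.\<close>
      hence "\<forall>\<^sub>F n in sequentially. max (1 / \<delta>) (2 / \<eta>) \<le> exp (\<epsilon> * real (m n))"
        unfolding filterlim_at_top by blast
      moreover have "\<forall>\<^sub>F n in sequentially. 0 < real (m n)"
        using m_top unfolding filterlim_at_top_dense by blast
      ultimately show "\<forall>\<^sub>F n in sequentially. measure (M n) {x \<in> space (M n).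
          ereal \<epsilon> < \<bar>ereal (1 / real (m n)) * log_partition (S n) \<beta> (\<lambda>e. \<omega> n e x) - ereal (log_laplace \<mu> \<beta>)\<bar>} \<le> \<eta>"
        using eventually_ge_at_top[of 1] tl
      proof eventually_elim
        case (elim n)
        interpret weighted_ensemble "M n" "E n" "\<omega> n" \<mu> "S n" "m n" g s by (rule ens[OF elim(3)])
        let ?e = "exp (\<epsilon> * real (m n))"
        have e: "1 / ?e \<le> \<delta>" "1 / ?e \<le> \<eta> / 2"
          using elim(1) \<delta> \<eta> by (simp_all add: field_simps)
        let ?A = "{x \<in> space (M n). Zbar x < \<delta>}" and ?B = "{x \<in> space (M n). Zbar x \<ge> ?e}"
        have AB: "?A \<in> events" "?B \<in> events"
          using borel_measurable_integrable[OF integrable_Zbar] by measurable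
        \<comment> \<open>The inclusion of events is only almost sure: the formula for the partition
          function needs weights different from \<open>- \<infinity>\<close>.\<close>
        have "prob {x \<in> space (M n).
          ereal \<epsilon> < \<bar>ereal (1 / real (m n)) * log_partition (S n) \<beta> (\<lambda>e. \<omega> n e x) - ereal (log_laplace \<mu> \<beta>)\<bar>}
          \<le> prob (?A \<union> ?B)"
        proof (rule finite_measure_mono_AE)
          show "AE x in M n. x \<in> {x \<in> space (M n). ereal \<epsilon> <
              \<bar>ereal (1 / real (m n)) * log_partition (S n) \<beta> (\<lambda>e. \<omega> n e x) - ereal (log_laplace \<mu> \<beta>)\<bar>}
              \<longrightarrow> x \<in> ?A \<union> ?B"
            using AE_not_minus_infinity[OF law_not_minf]
          proof eventually_elim
            case (elim x)
            have False if x: "ereal \<epsilon> < \<bar>ereal (1 / real (m n)) * log_partition (S n) \<beta> (\<lambda>e. \<omega> n e x) -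
                ereal (log_laplace \<mu> \<beta>)\<bar>" and Z: "\<delta> \<le> Zbar x" "Zbar x < ?e"
            proof -
              have m0: "0 < m n" using \<open>0 < real (m n)\<close> by simp
              have Z0: "0 < Zbar x" using Z \<delta> by linarith
              have "ln (Zbar x) \<le> \<epsilon> * real (m n)"
                using Z(2) Z0 by (metis less_imp_le ln_exp ln_le_cancel_iff exp_gt_zero)
              moreover have "- (\<epsilon> * real (m n)) \<le> ln (Zbar x)"
              proof -
                have "exp (- (\<epsilon> * real (m n))) \<le> Zbar x"
                  using e(1) Z(1) by (simp add: exp_minus inverse_eq_divide)
                thus ?thesis using Z0 by (simp add: ln_ge_iff)
              qed
              ultimately have "\<bar>ln (Zbar x) / real (m n)\<bar> \<le> \<epsilon>"
                using m0 by (simp add: abs_le_iff field_simps)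
              moreover have "\<epsilon> < \<bar>ln (Zbar x) / real (m n)\<bar>"
                using x unfolding scaled_log_partition_eq[OF g_def L m0 elim Z0]
                by (simp add: log_laplace_def L_def)
              ultimately show False by simp
            qed
            thus ?case by fastforce
          qed
        qed (use AB in auto)
        also have "\<dots> \<le> prob ?A + prob ?B" by (rule measure_Un_le[OF AB])
        also have "prob ?B \<le> 1 / ?e" by (rule prob_Zbar_ge) simp
        finally show ?case using elim(4) e(2) by linarith
      qed
    qed (rule measure_nonneg)
  next
    fix D assume D: "(log_laplace \<mu> has_real_derivative D) (at \<beta> within {0..})"
    note bw = integrable_boltzmann_weight expectation_boltzmann_weight
    note bw = bw[OF law_prob law_sets law_not_as_inf law_exp_moments beta_nonneg D]
    let ?r = "real_of_ereal"
    have r_meas: "?r \<in> borel_measurable borel" by measurable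
    have gr_eq: "g y * ?r y = boltzmann \<beta> y * ?r y / L" for y by (simp add: g_def)
    have gr_int: "integrable \<mu> (\<lambda>y. g y * ?r y)" unfolding gr_eq using bw(1) by simp
    have gr_mean: "(\<integral>y. g y * ?r y \<partial>\<mu>) = - D" unfolding gr_eq using bw(2) L by (simp add: L_def)
    show "tendsto_in_prob M (\<lambda>n x. ereal (1 / real (m n)) *
        gibbs_mean (S n) \<beta> (\<lambda>e. \<omega> n e x) (total_weight (\<lambda>e. \<omega> n e x))) (- D)"
      unfolding tendsto_in_prob_def
    proof (intro allI impI lim0)
      fix \<epsilon> \<eta> :: real assume \<epsilon>: "0 < \<epsilon>" and \<eta>: "0 < \<eta>"
      obtain \<delta> where \<delta>: "0 < \<delta>" and tl: "\<forall>\<^sub>F n in sequentially.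
          measure (M n) {x \<in> space (M n). weighted_ensemble.Zbar (\<omega> n) (S n) g x < \<delta>} \<le> \<eta> / 2"
        using tail[of "\<eta> / 2"] \<eta> by auto
      \<comment> \<open>Chosen so that the bound \<open>4 * \<kappa> * m\<close> on the mean of
        \<open>Dev\<close>, divided by the threshold \<open>\<epsilon> * \<delta> * m\<close>, is
        \<open>\<eta> / 2\<close>.\<close>
      define \<kappa> where "\<kappa> = \<eta> * \<epsilon> * \<delta> / 8"
      have \<kappa>: "0 < \<kappa>" using \<eta> \<epsilon> \<delta> by (simp add: \<kappa>_def)
      have "\<exists>K. (\<integral>y. g y * \<bar>?r y - (if \<bar>?r y\<bar> \<le> K then ?r y else 0)\<bar> \<partial>\<mu>) < \<kappa>"
        by (rule truncation_error_small[OF gr_int _ _ g_nonneg \<kappa>])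
           (use r_meas g_meas in \<open>simp_all add: measurable_cong_sets[OF law_sets refl]\<close>)
      then obtain K' where K': "(\<integral>y. g y * \<bar>?r y - (if \<bar>?r y\<bar> \<le> K' then ?r y else 0)\<bar> \<partial>\<mu>) < \<kappa>" ..
      define k where "k y = (if \<bar>?r y\<bar> \<le> K' then ?r y else 0)" for y
      \<comment> \<open>A negative level \<open>K'\<close> makes \<open>k\<close> vanish
        identically; the maximum with 0 keeps \<open>\<bar>k y\<bar> \<le> K\<close> true in that
        case.\<close>
      define K where "K = max 0 K'"
      have k_meas: "k \<in> borel_measurable borel" unfolding k_def[abs_def] by measurable
      have kK: "\<bar>k y\<bar> \<le> K" for y by (auto simp: k_def K_def le_max_iff_disj simp del: abs_real_of_ereal)
      have "\<forall>\<^sub>F n in sequentially. (2 * K)\<^sup>2 / \<kappa>\<^sup>2 < real (m n)"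
        using m_top unfolding filterlim_at_top_dense by blast
      moreover have "\<forall>\<^sub>F n in sequentially. 0 < real (m n)"
        using m_top unfolding filterlim_at_top_dense by blast
      ultimately show "\<forall>\<^sub>F n in sequentially. measure (M n) {x \<in> space (M n).
          ereal \<epsilon> < \<bar>ereal (1 / real (m n)) * gibbs_mean (S n) \<beta> (\<lambda>e. \<omega> n e x)
            (total_weight (\<lambda>e. \<omega> n e x)) - ereal (- D)\<bar>} \<le> \<eta>"
        using eventually_ge_at_top[of 1] tl
      proof eventually_elim
        case (elim n)
        interpret weighted_ensemble "M n" "E n" "\<omega> n" \<mu> "S n" "m n" g s by (rule ens[OF elim(3)])
        have m0: "0 < m n" using elim(2) by simp
        \<comment> \<open>Where \<open>Zbar \<ge> \<delta>\<close>, a deviation of the mean weight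
          above \<open>\<epsilon>\<close> forces \<open>Dev\<close> above this threshold.\<close>
        let ?Dev = "Dev ?r (- D)" and ?t = "\<epsilon> * \<delta> * real (m n)"
        have t: "0 < ?t" using \<epsilon> \<delta> m0 by simp
        have \<kappa>m: "0 < \<kappa> * real (m n)" using \<kappa> m0 by simp
        note Dev = integrable_Dev[OF r_meas gr_int gr_mean k_meas kK \<kappa>m]
          expectation_Dev_le[OF r_meas gr_int gr_mean k_meas kK \<kappa>m]
        let ?A = "{x \<in> space (M n). Zbar x < \<delta>}" and ?B = "{x \<in> space (M n). ?Dev x \<ge> ?t}"
        have AB: "?A \<in> events" "?B \<in> events"
          using borel_measurable_integrable[OF integrable_Zbar] borel_measurable_integrable[OF Dev(1)]
          by measurable
        have "prob {x \<in> space (M n). ereal \<epsilon> < \<bar>ereal (1 / real (m n)) *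
            gibbs_mean (S n) \<beta> (\<lambda>e. \<omega> n e x) (total_weight (\<lambda>e. \<omega> n e x)) - ereal (- D)\<bar>}
          \<le> prob (?A \<union> ?B)"
        proof (rule finite_measure_mono_AE)
          show "AE x in M n. x \<in> {x \<in> space (M n). ereal \<epsilon> < \<bar>ereal (1 / real (m n)) *
              gibbs_mean (S n) \<beta> (\<lambda>e. \<omega> n e x) (total_weight (\<lambda>e. \<omega> n e x)) - ereal (- D)\<bar>}
              \<longrightarrow> x \<in> ?A \<union> ?B"
            using AE_not_minus_infinity[OF law_not_minf]
          proof eventually_elim
            case (elim x)
            have "?t \<le> ?Dev x" if x: "ereal \<epsilon> < \<bar>ereal (1 / real (m n)) *
                gibbs_mean (S n) \<beta> (\<lambda>e. \<omega> n e x) (total_weight (\<lambda>e. \<omega> n e x)) - ereal (- D)\<bar>"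
              and Z: "\<delta> \<le> Zbar x"
            proof -
              have Z0: "0 < Zbar x" using Z \<delta> by linarith
              have "ereal \<epsilon> < ereal (?Dev x / (real (m n) * Zbar x))"
                by (rule less_le_trans[OF x scaled_gibbs_mean_deviation_le[OF g_def L m0 elim Z0]])
              hence "\<epsilon> * (real (m n) * Zbar x) < ?Dev x"
                using m0 Z0 by (simp add: less_divide_eq)
              moreover have "?t \<le> \<epsilon> * (real (m n) * Zbar x)"
                using mult_left_mono[OF Z, of "\<epsilon> * real (m n)"] \<epsilon> by (simp add: mult_ac)
              ultimately show ?thesis by linarith
            qed
            thus ?case by fastforce
          qed
        qed (use AB in auto)
        also have "\<dots> \<le> prob ?A + prob ?B" by (rule measure_Un_le[OF AB])
        also have "prob ?B \<le> \<eta> / 2"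
        proof -
          have "prob ?B \<le> expectation ?Dev / ?t"
            by (rule integral_Markov_inequality_measure[OF Dev(1) sets.empty_sets _ t]) (simp add: Dev_nonneg)
          \<comment> \<open>With \<open>\<theta> = \<kappa> * m\<close> the three terms of the bound
            are at most \<open>\<kappa> * m\<close>, \<open>\<kappa> * m\<close> and
            \<open>2 * \<kappa> * m\<close>; the first because \<open>m\<close> exceeds
            \<open>(2 * K)\<^sup>2 / \<kappa>\<^sup>2\<close>.\<close>
          also have "expectation ?Dev \<le> 4 * \<kappa> * real (m n)"
          proof -
            have "real (m n) * (2 * K)\<^sup>2 / (\<kappa> * real (m n)) \<le> \<kappa> * real (m n)"
            proof -
              have "real (m n) * (2 * K)\<^sup>2 / (\<kappa> * real (m n)) = \<kappa> * ((2 * K)\<^sup>2 / \<kappa>\<^sup>2)"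
                using m0 \<kappa> by (simp add: power2_eq_square)
              also have "\<dots> \<le> \<kappa> * real (m n)" using elim(1) \<kappa> by (intro mult_left_mono) auto
              finally show ?thesis .
            qed
            moreover have "2 * real (m n) * (\<integral>y. g y * \<bar>?r y - k y\<bar> \<partial>\<mu>) \<le> 2 * real (m n) * \<kappa>"
              using K' unfolding k_def by (intro mult_left_mono) auto
            ultimately show ?thesis using Dev(2) by (simp only: mult_ac) 
          qed
          hence "expectation ?Dev / ?t \<le> 4 * \<kappa> * real (m n) / ?t"
            using t by (intro divide_right_mono) auto
          also have "4 * \<kappa> * real (m n) / ?t = \<eta> / 2"
            using \<epsilon> \<delta> m0 by (simp add: \<kappa>_def)
          finally show ?thesis .
        qed
        finally show ?case using elim(4) by linarith
      qed
    qed (rule measure_nonneg)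
  qed
qed

end
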